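(* Let $\mathfrak g=\mathfrak{gl}(1|2)$, $\mathfrak k=\mathfrak{osp}(1|2)\subset\mathfrak g$, and $\mathcal I=\mathfrak kU(\mathfrak g)+U(\mathfrak g)\mathfrak k$. With the basis $z,k,k_1,k_2,e',f',p,e,f$ of $\mathfrak g$ and the polynomials $\beta_{n-1}$ specified in the context, the following vectors in $U(\mathfrak g)$ together form a basis of $\mathcal I$: (i) $z^mp^ne$ and $z^mp^nf$, where $m,n\ge 0$; (ii) $z^m\beta_{n-1}(p)ef-z^mp^{n+1}$, where $m,n\ge0$, with the convention $\beta_{-1}(x):=0$; (iii) $z^mk^{r_1}k_1^{r_2}k_2^{r_3}(e')^{r_4}(f')^{r_5}p^{s_1}e^{s_2}f^{s_3}$, where $m,r_1,r_2,r_3,s_1\ge0$, $r_4,r_5,s_2,s_3\in\{0,1\}$, and at least one of $r_1,\dots,r_5$ is $\ge1$.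
   Context: The base field is $\mathbb C$. $\mathfrak g=\mathfrak{gl}(1|2)$ is the Lie superalgebra of $3\times3$ complex matrices, whose first row/column index is even and whose second and third indices are odd, with supercommutator bracket. $E_{ij}$ ($1\le i,j\le3$) are the matrix units. $\mathfrak k=\mathfrak{osp}(1|2)$ is the subalgebra of matrices $\begin{bmatrix} 0 & a_{12} & a_{13} \\ -a_{13} & a_{22} & a_{23} \\ a_{12} & a_{32} & -a_{22} \end{bmatrix}$. All products below are taken in $U(\mathfrak g)$. Basis of $\mathfrak g$: $z=E_{11}+E_{22}+E_{33}$, $k=E_{22}-E_{33}$, $k_1=E_{23}$, $k_2=E_{32}$, $e'=E_{12}+E_{31}$, $f'=E_{13}-E_{21}$, $p=2E_{11}+E_{22}+E_{33}$, $e=E_{12}-E_{31}$, $f=E_{13}+E_{21}$. For $v=(a,b)\in\mathbb C^2$ set $v_{\mathfrak p}:=ae+bf$ and $v_{\mathfrak k}:=ae'+bf'$. Then $[v_{\mathfrak p},p]=-v_{\mathfrak k}$ and $[v_{\mathfrak k},p]=-v_{\mathfrak p}$. For $n\ge0$, $\alpha_n(x)$ and $\beta_{n-1}(x)$ are the unique polynomials, independent of $v$, such that in $U(\mathfrak g)$ one has $p^nv_{\mathfrak k}=v_{\mathfrak k}\alpha_n(p)+\beta_{n-1}(p)v_{\mathfrak p}$ for all $v\in\mathbb C^2$. *)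

theory Defs
  imports
    "HOL-Analysis.Analysis"
    "HOL-Library.Poly_Mapping"
    "HOL-Computational_Algebra.Polynomial"
begin

text \<open>
  The index type \<^typ>\<open>3\<close> has the elements \<open>1\<close>, \<open>2\<close>, \<open>3\<close> (with \<open>3 = 0\<close>, which is harmless here);
  the index \<open>1\<close> is even, the other two are odd.
\<close>

type_synonym gl12 = "complex^3^3"

definition parity :: "3 \<Rightarrow> nat" where
  "parity i = (if i = 1 then 0 else 1)"

definition E :: "3 \<Rightarrow> 3 \<Rightarrow> gl12" where
  "E i j = (\<chi> a b. if a = i \<and> b = j then 1 else 0)"

definition gscale :: "complex \<Rightarrow> gl12 \<Rightarrow> gl12" where
  "gscale c A = (\<chi> i j. c * A $ i $ j)"

definition component :: "nat \<Rightarrow> gl12 \<Rightarrow> gl12" where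
  "component s A = (\<chi> i j. if (parity i + parity j) mod 2 = s then A $ i $ j else 0)"

definition homogeneous :: "nat \<Rightarrow> gl12 \<Rightarrow> bool" where
  "homogeneous s A \<longleftrightarrow> component s A = A"

text \<open>The supercommutator \<open>AB - (-1)^(st) BA\<close> of homogeneous elements of parities
  \<open>s\<close> and \<open>t\<close>, extended bilinearly.\<close>

definition sbracket :: "gl12 \<Rightarrow> gl12 \<Rightarrow> gl12" where
  "sbracket A B = (\<Sum>s\<in>{0,1}. \<Sum>t\<in>{0,1}.
     component s A ** component t B
       - gscale ((-1) ^ (s * t)) (component t B ** component s A))"

definition osp12 :: "gl12 set" where
  "osp12 = {vector [vector [  0, a12,  a13],
                    vector [-a13, a22,  a23],
                    vector [ a12, a32, -a22]] | a12 a13 a22 a23 a32. True}"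

definition g_z  :: gl12 where "g_z  = E 1 1 + E 2 2 + E 3 3"
definition g_k  :: gl12 where "g_k  = E 2 2 - E 3 3"
definition g_k1 :: gl12 where "g_k1 = E 2 3"
definition g_k2 :: gl12 where "g_k2 = E 3 2"
definition g_e' :: gl12 where "g_e' = E 1 2 + E 3 1"
definition g_f' :: gl12 where "g_f' = E 1 3 - E 2 1"
definition g_p  :: gl12 where "g_p  = gscale 2 (E 1 1) + E 2 2 + E 3 3"
definition g_e  :: gl12 where "g_e  = E 1 2 - E 3 1"
definition g_f  :: gl12 where "g_f  = E 1 3 + E 2 1"

text \<open>
  The free associative algebra on the set \<^typ>\<open>gl12\<close>: finitely supported complex functions on
  words, multiplied by convolution.  For this, words form a monoid under concatenation, written
  additively.  The tensor algebra is the quotient by the relations expressing linearity of the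
  inclusion of the generators; the ideal below contains these relations as well as the
  supercommutator relations.
\<close>

instantiation list :: (type) monoid_add
begin
definition zero_list :: "'a list" where "zero_list = []"
definition plus_list :: "'a list \<Rightarrow> 'a list \<Rightarrow> 'a list" where "plus_list = append"
instance by standard (simp_all add: zero_list_def plus_list_def)
end

type_synonym free_alg = "gl12 list \<Rightarrow>\<^sub>0 complex"

definition gen :: "gl12 \<Rightarrow> free_alg" where
  "gen x = Poly_Mapping.single [x] 1"

definition const :: "complex \<Rightarrow> free_alg" where
  "const c = Poly_Mapping.single [] c"

inductive_set env_ideal :: "free_alg set" where
  add:   "gen (x + y) - (gen x + gen y) \<in> env_ideal"
| scale: "gen (gscale c x) - const c * gen x \<in> env_ideal"
| super: "homogeneous s x \<Longrightarrow> homogeneous t y \<Longrightarrow> s \<in> {0,1} \<Longrightarrow> t \<in> {0,1} \<Longrightarrow>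
    gen x * gen y - const ((-1) ^ (s * t)) * (gen y * gen x) - gen (sbracket x y) \<in> env_ideal"
| zero:  "0 \<in> env_ideal"
| plus:  "a \<in> env_ideal \<Longrightarrow> b \<in> env_ideal \<Longrightarrow> a + b \<in> env_ideal"
| left:  "a \<in> env_ideal \<Longrightarrow> u * a \<in> env_ideal"
| right: "a \<in> env_ideal \<Longrightarrow> a * u \<in> env_ideal"

definition env_rel :: "free_alg \<Rightarrow> free_alg \<Rightarrow> bool" where
  "env_rel a b \<longleftrightarrow> a - b \<in> env_ideal"

lemma env_ideal_uminus: "a \<in> env_ideal \<Longrightarrow> - a \<in> env_ideal"
  using env_ideal.left[of a "-1"] by simp

lemma env_rel_equivp: "equivp env_rel"
proof (rule equivpI)
  show "reflp env_rel"
    by (auto simp: reflp_def env_rel_def intro: env_ideal.zero)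
  show "symp env_rel"
    by (auto simp: symp_def env_rel_def dest: env_ideal_uminus)
  show "transp env_rel"
    unfolding transp_def env_rel_def
    by (metis (no_types) add_diff_cancel_left' diff_add_cancel diff_add_eq env_ideal.plus)
qed

quotient_type uea = free_alg / env_rel
  by (rule env_rel_equivp)

lemma const_add: "const (a + b) = const a + const b"
  by (simp add: const_def single_add)

lemma const_mult: "const (a * b) = const a * const b"
  by (simp add: const_def mult_single plus_list_def)

lemma const_0: "const 0 = 0"
  by (simp add: const_def)

lemma const_1: "const 1 = 1"
  by (simp add: const_def zero_list_def[symmetric])

lemma poly_mapping_induct [case_names single add]:
  fixes f :: "'a \<Rightarrow>\<^sub>0 'b :: monoid_add"
  assumes "\<And>k c. P (Poly_Mapping.single k c)"
    and "\<And>f g. P f \<Longrightarrow> P g \<Longrightarrow> P (f + g)"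
  shows "P f"
proof (induction f rule: update_induct)
  case const
  show ?case using assms(1)[of undefined 0] by simp
next
  case (update f a b)
  have "Poly_Mapping.update a b f = Poly_Mapping.single a b + f"
    using update.hyps(1)
    by (intro poly_mapping_eqI)
       (auto simp: lookup_update lookup_add lookup_single when_def in_keys_iff)
  then show ?case using assms update.IH by simp
qed

lemma const_commute: "const c * x = x * const c"
  by (induction x rule: poly_mapping_induct)
     (simp_all add: const_def mult_single plus_list_def mult.commute distrib_left distrib_right)

lemma lookup_Nil_mult:
  "Poly_Mapping.lookup (x * y) [] = Poly_Mapping.lookup x [] * Poly_Mapping.lookup (y :: free_alg) []"
proof (induction x rule: poly_mapping_induct)
  case (single k c)
  show ?case
    by (induction y rule: poly_mapping_induct)
       (auto simp: mult_single plus_list_def lookup_single when_def distrib_left lookup_add)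
qed (simp add: distrib_right lookup_add)

lemma env_ideal_lookup_Nil: "a \<in> env_ideal \<Longrightarrow> Poly_Mapping.lookup a [] = 0"
  by (induction rule: env_ideal.induct)
     (simp_all add: lookup_Nil_mult lookup_minus lookup_add gen_def lookup_single)

instantiation uea :: ring_1
begin

lift_definition zero_uea :: uea is "0 :: free_alg" .
lift_definition one_uea :: uea is "1 :: free_alg" .

lift_definition plus_uea :: "uea \<Rightarrow> uea \<Rightarrow> uea" is "(+) :: free_alg \<Rightarrow> _"
  unfolding env_rel_def by (metis add_diff_add env_ideal.plus)

lift_definition uminus_uea :: "uea \<Rightarrow> uea" is "uminus :: free_alg \<Rightarrow> _"
  unfolding env_rel_def by (metis env_ideal_uminus minus_diff_minus)

lift_definition minus_uea :: "uea \<Rightarrow> uea \<Rightarrow> uea" is "(-) :: free_alg \<Rightarrow> _"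
proof -
  fix a b c d :: free_alg
  assume "env_rel a b" "env_rel c d"
  then have "(a - b) + - (c - d) \<in> env_ideal"
    unfolding env_rel_def by (intro env_ideal.plus env_ideal_uminus)
  then show "env_rel (a - c) (b - d)"
    unfolding env_rel_def by (simp add: algebra_simps)
qed

lift_definition times_uea :: "uea \<Rightarrow> uea \<Rightarrow> uea" is "(*) :: free_alg \<Rightarrow> _"
proof -
  fix a b c d :: free_alg
  assume "env_rel a b" "env_rel c d"
  then have "(a - b) * c + b * (c - d) \<in> env_ideal"
    unfolding env_rel_def by (intro env_ideal.plus env_ideal.left env_ideal.right)
  then show "env_rel (a * c) (b * d)"
    unfolding env_rel_def by (simp add: algebra_simps)
qed

instance
proof
  show "(0::uea) \<noteq> 1"
  proof (transfer, unfold env_rel_def, rule notI)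
    assume "0 - 1 \<in> env_ideal"
    from env_ideal_lookup_Nil[OF this] show False
      by (simp add: lookup_minus lookup_one zero_list_def)
  qed
qed (transfer; simp add: env_rel_def env_ideal.zero algebra_simps)+

end

lift_definition uscale :: "complex \<Rightarrow> uea \<Rightarrow> uea" is "\<lambda>c x. const c * x"
  unfolding env_rel_def by (metis env_ideal.left right_diff_distrib)

interpretation uea: vector_space uscale
  by standard
     (transfer; simp add: env_rel_def env_ideal.zero const_add const_mult const_1 algebra_simps)+

lemma uscale_mult_left: "uscale c (x * y) = uscale c x * y"
  by transfer (simp add: env_rel_def env_ideal.zero algebra_simps)

lemma uscale_mult_right: "uscale c (x * y) = x * uscale c y"
proof transfer
  fix c and x y :: free_alg
  have "const c * (x * y) = x * (const c * y)"
    by (metis const_commute mult.assoc)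
  then show "env_rel (const c * (x * y)) (x * (const c * y))"
    by (simp add: env_rel_def env_ideal.zero)
qed

text \<open>The canonical map from gl(1|2) to its universal enveloping algebra.\<close>

lift_definition \<iota> :: "gl12 \<Rightarrow> uea" is gen .

lemma \<iota>_add: "\<iota> (x + y) = \<iota> x + \<iota> y"
  by transfer (simp only: env_rel_def env_ideal.add)

lemma \<iota>_scale: "\<iota> (gscale c x) = uscale c (\<iota> x)"
  by transfer (simp only: env_rel_def env_ideal.scale)

lemma \<iota>_super:
  assumes "homogeneous s x" "homogeneous t y" "s \<in> {0,1}" "t \<in> {0,1}"
  shows "\<iota> x * \<iota> y - uscale ((-1) ^ (s * t)) (\<iota> y * \<iota> x) = \<iota> (sbracket x y)"
  using assms by transfer (simp only: env_rel_def env_ideal.super)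

definition kU :: "uea set" where
  "kU = uea.span {\<iota> x * u | x u. x \<in> osp12}"

definition Uk :: "uea set" where
  "Uk = uea.span {u * \<iota> x | x u. x \<in> osp12}"

definition \<I> :: "uea set" where
  "\<I> = {a + b | a b. a \<in> kU \<and> b \<in> Uk}"

definition peval :: "complex poly \<Rightarrow> uea \<Rightarrow> uea" where
  "peval q x = (\<Sum>i\<le>degree q. uscale (coeff q i) (x ^ i))"

definition v_p :: "complex \<Rightarrow> complex \<Rightarrow> gl12" where
  "v_p a b = gscale a g_e + gscale b g_f"

definition v_k :: "complex \<Rightarrow> complex \<Rightarrow> gl12" where
  "v_k a b = gscale a g_e' + gscale b g_f'"

text \<open>\<open>alpha_beta n\<close> is the pair \<open>(\<alpha>\<^sub>n, \<beta>\<^sub>n\<^sub>-\<^sub>1)\<close>;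
  \<open>beta_pred n\<close> is \<open>\<beta>\<^sub>n\<^sub>-\<^sub>1\<close>, with the index shifted so as to be a natural number.\<close>

definition alpha_beta :: "nat \<Rightarrow> complex poly \<times> complex poly" where
  "alpha_beta n = (THE (\<alpha>, \<beta>). \<forall>a b.
     \<iota> g_p ^ n * \<iota> (v_k a b) = \<iota> (v_k a b) * peval \<alpha> (\<iota> g_p) + peval \<beta> (\<iota> g_p) * \<iota> (v_p a b))"

definition beta_pred :: "nat \<Rightarrow> complex poly" where
  "beta_pred n = (if n = 0 then 0 else snd (alpha_beta n))"

datatype index =
    Idx_e nat nat | Idx_f nat nat
  | Idx_ii nat nat
  | Idx_iii nat nat nat nat nat nat nat nat nat

definition indices :: "index set" where
  "indices =
     {Idx_e m n | m n. True} \<union> {Idx_f m n | m n. True} \<union> {Idx_ii m n | m n. True} \<union>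
     {Idx_iii m r1 r2 r3 r4 r5 s1 s2 s3 | m r1 r2 r3 r4 r5 s1 s2 s3.
        r4 \<in> {0,1} \<and> r5 \<in> {0,1} \<and> s2 \<in> {0,1} \<and> s3 \<in> {0,1} \<and>
        (r1 \<ge> 1 \<or> r2 \<ge> 1 \<or> r3 \<ge> 1 \<or> r4 \<ge> 1 \<or> r5 \<ge> 1)}"

fun vec_of :: "index \<Rightarrow> uea" where
  "vec_of (Idx_e m n) = \<iota> g_z ^ m * \<iota> g_p ^ n * \<iota> g_e"
| "vec_of (Idx_f m n) = \<iota> g_z ^ m * \<iota> g_p ^ n * \<iota> g_f"
| "vec_of (Idx_ii m n) =
     \<iota> g_z ^ m * peval (beta_pred n) (\<iota> g_p) * \<iota> g_e * \<iota> g_f - \<iota> g_z ^ m * \<iota> g_p ^ (n + 1)"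
| "vec_of (Idx_iii m r1 r2 r3 r4 r5 s1 s2 s3) =
     \<iota> g_z ^ m * \<iota> g_k ^ r1 * \<iota> g_k1 ^ r2 * \<iota> g_k2 ^ r3 * \<iota> g_e' ^ r4 * \<iota> g_f' ^ r5
       * \<iota> g_p ^ s1 * \<iota> g_e ^ s2 * \<iota> g_f ^ s3"

end

theory Submission
  imports Defs "HOL-Library.Multiset"
begin

text \<open>
  Write \<open>U\<close> for the enveloping algebra. The argument rests on the PBW theorem for the ordered
  basis \<open>z, k, k\<^sub>1, k\<^sub>2, e', f', p, e, f\<close>, in which the basis of \<open>\<kk>\<close> stands between the central
  \<open>z\<close> and the remaining \<open>p, e, f\<close>.

  Since products of elements of \<open>\<kk>\<close> can be straightened inside
  \<open>\<kk>\<close>, the right ideal \<open>\<kk>U\<close> is spanned exactly by the ordered monomials that contain a letter of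
  \<open>\<kk>\<close>, which are the vectors of type (iii) (\<open>kU_eq\<close>). Modulo \<open>\<kk>U\<close>, the monomials
  \<open>z\<^sup>m p\<^sup>n e\<^sup>a f\<^sup>b\<close> with \<open>a, b \<le> 1\<close> remain.

  As \<open>\<kk>\<close> is generated by its odd elements, \<open>U\<kk> = Ue' + Uf'\<close>. Hence only the
  products of \<open>z\<^sup>m p\<^sup>n e\<^sup>a f\<^sup>b\<close> with \<open>e'\<close> and \<open>f'\<close> have to be reduced modulo \<open>\<kk>U\<close>. The relation
  \<open>p\<^sup>n v\<^sub>\<kk> = v\<^sub>\<kk> \<alpha>\<^sub>n(p) + \<beta>\<^sub>n\<^sub>-\<^sub>1(p) v\<^sub>\<pp>\<close> replaces an \<open>e'\<close> or \<open>f'\<close> that follows \<open>p\<^sup>n\<close> by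
  \<open>\<beta>\<^sub>n\<^sub>-\<^sub>1(p) e\<close> or \<open>\<beta>\<^sub>n\<^sub>-\<^sub>1(p) f\<close>, and the eight products become, up to sign, \<open>0\<close>,
  \<open>\<beta>\<^sub>n\<^sub>-\<^sub>1(p) e\<close>, \<open>\<beta>\<^sub>n\<^sub>-\<^sub>1(p) f\<close>, \<open>\<beta>\<^sub>n\<^sub>-\<^sub>1(p) ef - p\<^sup>n\<^sup>+\<^sup>1\<close>, \<open>(p\<^sup>n\<^sup>+\<^sup>1 - \<beta>\<^sub>n\<^sub>-\<^sub>1(p)) e\<close> and
  \<open>(p\<^sup>n\<^sup>+\<^sup>1 - \<beta>\<^sub>n\<^sub>-\<^sub>1(p)) f\<close>. All of them lie in the span of (i) and (ii). Conversely, (ii) is congruent to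
  one of these products, and since \<open>\<beta>\<^sub>n\<^sub>-\<^sub>1\<close> has degree at most \<open>n\<close>, the last two yield by induction on \<open>n\<close> all
  \<open>p\<^sup>n e\<close> and \<open>p\<^sup>n f\<close>, that is, (i).

  As for independence, the vectors of types (i) and (iii) are different PBW monomials. The vector of type
  (ii) is \<open>-z\<^sup>m p\<^sup>n\<^sup>+\<^sup>1\<close> plus monomials \<open>z\<^sup>m p\<^sup>j ef\<close>. So each vector contains a PBW monomial that occurs in
  no other one (\<open>pbw_coord_lead\<close>).

  In the PBW theorem, spanning is the usual straightening (\<open>straightening\<close>). For the independence of the
  ordered monomials, let
  \<open>V = \<complex>1 \<oplus> M\<^sub>3(\<complex>)\<close> be the algebra of matrices with a new unit adjoined, on which \<open>\<gg>\<close>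
  acts by left multiplication, and apply a monomial of degree \<open>n\<close> to \<open>1 \<otimes> \<dots> \<otimes> 1\<close> in the super
  tensor power \<open>V\<^sup>\<otimes>\<^sup>n\<close>. The part of the result that has no tensor factor in \<open>\<complex>1\<close> arises by
  distributing the \<open>n\<close> letters over the \<open>n\<close> factors in all ways. Hence the coordinate labelled by the letters of
  the monomial itself is a product of factorials, whereas it vanishes for the other ordered monomials
  of degree at most \<open>n\<close> (\<open>pairing_self\<close>, \<open>pairing_zero\<close>). A linear relation is
  refuted by looking at one of its monomials of highest degree (\<open>pbw_independent\<close>).

  The polynomials are found as follows. With \<open>w = v\<^sub>\<kk> + v\<^sub>\<pp>\<close> and \<open>u = v\<^sub>\<kk> - v\<^sub>\<pp>\<close> one has \<open>pw = w(p + 1)\<close> and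
  \<open>pu = u(p - 1)\<close>. From this, \<open>\<alpha>\<^sub>n\<close> is the polynomial with
  \<open>\<alpha>\<^sub>n(x + 1) + \<alpha>\<^sub>n(x - 1) = 2x\<^sup>n\<close>, and \<open>\<beta>\<^sub>n\<^sub>-\<^sub>1(x) = (\<alpha>\<^sub>n(x + 1) - \<alpha>\<^sub>n(x - 1))/2\<close>
  (\<open>p_power_relation_exists\<close>). Their uniqueness is an instance of PBW independence.
\<close>

section \<open>Basis and coordinates of gl(1|2)\<close>

definition basis :: "nat \<Rightarrow> gl12" where
  "basis i = [g_z, g_k, g_k1, g_k2, g_e', g_f', g_p, g_e, g_f] ! i"

definition basis_parity :: "nat \<Rightarrow> nat" where
  "basis_parity i = (if i \<in> {4, 5, 7, 8} then 1 else 0)"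

text \<open>
  The dual basis. The value \<open>0\<close> at indices from \<open>9\<close> on makes linearity and
  \<open>coord_homogeneous\<close> hold for every index.
\<close>
definition coord :: "nat \<Rightarrow> gl12 \<Rightarrow> complex" where
  "coord i A = (if i < 9 then
     [A$2$2 + A$3$3 - A$1$1, (A$2$2 - A$3$3) / 2, A$2$3, A$3$2,
      (A$1$2 + A$3$1) / 2, (A$1$3 - A$2$1) / 2,
      A$1$1 - (A$2$2 + A$3$3) / 2, (A$1$2 - A$3$1) / 2, (A$1$3 + A$2$1) / 2] ! i else 0)"

lemma less_9_cases: "i < 9 \<longleftrightarrow> i \<in> {0,1,2,3,4,5,6,7,8::nat}"
  by auto

lemma lessThan_9: "{..<9::nat} = {0,1,2,3,4,5,6,7,8}"
  by auto

lemma index_distinct: "(1::3) \<noteq> 2" "(1::3) \<noteq> 3" "(2::3) \<noteq> 3" "(2::3) \<noteq> 1" "(3::3) \<noteq> 1" "(3::3) \<noteq> 2"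
  by simp_all

lemma coord_add: "coord i (A + B) = coord i A + coord i B"
proof (cases "i < 9")
  case True
  then show ?thesis unfolding less_9_cases
    by (elim insertE emptyE) (simp_all add: coord_def add_divide_distrib diff_divide_distrib)
qed (simp add: coord_def)

lemma coord_gscale: "coord i (gscale c A) = c * coord i A"
proof (cases "i < 9")
  case True
  then show ?thesis unfolding less_9_cases
    by (elim insertE emptyE) (simp_all add: coord_def gscale_def algebra_simps)
qed (simp add: coord_def)

lemma basis_simps:
  "basis 0 = g_z" "basis 1 = g_k" "basis (Suc 0) = g_k" "basis 2 = g_k1" "basis 3 = g_k2" "basis 4 = g_e'"
  "basis 5 = g_f'" "basis 6 = g_p" "basis 7 = g_e" "basis 8 = g_f"
  by (simp_all add: basis_def)

lemma coord_simps:
  "coord 0 A = A$2$2 + A$3$3 - A$1$1"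
  "coord 1 A = (A$2$2 - A$3$3) / 2"
  "coord (Suc 0) A = (A$2$2 - A$3$3) / 2"
  "coord 2 A = A$2$3"
  "coord 3 A = A$3$2"
  "coord 4 A = (A$1$2 + A$3$1) / 2"
  "coord 5 A = (A$1$3 - A$2$1) / 2"
  "coord 6 A = A$1$1 - (A$2$2 + A$3$3) / 2"
  "coord 7 A = (A$1$2 - A$3$1) / 2"
  "coord 8 A = (A$1$3 + A$2$1) / 2"
  by (simp_all add: coord_def)

lemma entries:
  "(A + B) $ i $ j = A $ i $ j + B $ i $ (j::3)"
  "(A - B) $ i $ j = A $ i $ j - B $ i $ (j::3)"
  "gscale c A $ i $ j = c * A $ i $ j"
  "E i' j' $ i $ j = (if i = i' \<and> j = j' then 1 else 0)"
  by (simp_all add: gscale_def E_def)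

lemma basis_entries:
  "g_z $ 1 $ 1 = 1" "g_z $ 1 $ 2 = 0" "g_z $ 1 $ 3 = 0"
  "g_z $ 2 $ 1 = 0" "g_z $ 2 $ 2 = 1" "g_z $ 2 $ 3 = 0"
  "g_z $ 3 $ 1 = 0" "g_z $ 3 $ 2 = 0" "g_z $ 3 $ 3 = 1"
  "g_k $ 1 $ 1 = 0" "g_k $ 1 $ 2 = 0" "g_k $ 1 $ 3 = 0"
  "g_k $ 2 $ 1 = 0" "g_k $ 2 $ 2 = 1" "g_k $ 2 $ 3 = 0"
  "g_k $ 3 $ 1 = 0" "g_k $ 3 $ 2 = 0" "g_k $ 3 $ 3 = -1"
  "g_k1 $ 1 $ 1 = 0" "g_k1 $ 1 $ 2 = 0" "g_k1 $ 1 $ 3 = 0"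
  "g_k1 $ 2 $ 1 = 0" "g_k1 $ 2 $ 2 = 0" "g_k1 $ 2 $ 3 = 1"
  "g_k1 $ 3 $ 1 = 0" "g_k1 $ 3 $ 2 = 0" "g_k1 $ 3 $ 3 = 0"
  "g_k2 $ 1 $ 1 = 0" "g_k2 $ 1 $ 2 = 0" "g_k2 $ 1 $ 3 = 0"
  "g_k2 $ 2 $ 1 = 0" "g_k2 $ 2 $ 2 = 0" "g_k2 $ 2 $ 3 = 0"
  "g_k2 $ 3 $ 1 = 0" "g_k2 $ 3 $ 2 = 1" "g_k2 $ 3 $ 3 = 0"
  "g_e' $ 1 $ 1 = 0" "g_e' $ 1 $ 2 = 1" "g_e' $ 1 $ 3 = 0"
  "g_e' $ 2 $ 1 = 0" "g_e' $ 2 $ 2 = 0" "g_e' $ 2 $ 3 = 0"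
  "g_e' $ 3 $ 1 = 1" "g_e' $ 3 $ 2 = 0" "g_e' $ 3 $ 3 = 0"
  "g_f' $ 1 $ 1 = 0" "g_f' $ 1 $ 2 = 0" "g_f' $ 1 $ 3 = 1"
  "g_f' $ 2 $ 1 = -1" "g_f' $ 2 $ 2 = 0" "g_f' $ 2 $ 3 = 0"
  "g_f' $ 3 $ 1 = 0" "g_f' $ 3 $ 2 = 0" "g_f' $ 3 $ 3 = 0"
  "g_p $ 1 $ 1 = 2" "g_p $ 1 $ 2 = 0" "g_p $ 1 $ 3 = 0"
  "g_p $ 2 $ 1 = 0" "g_p $ 2 $ 2 = 1" "g_p $ 2 $ 3 = 0"
  "g_p $ 3 $ 1 = 0" "g_p $ 3 $ 2 = 0" "g_p $ 3 $ 3 = 1"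
  "g_e $ 1 $ 1 = 0" "g_e $ 1 $ 2 = 1" "g_e $ 1 $ 3 = 0"
  "g_e $ 2 $ 1 = 0" "g_e $ 2 $ 2 = 0" "g_e $ 2 $ 3 = 0"
  "g_e $ 3 $ 1 = -1" "g_e $ 3 $ 2 = 0" "g_e $ 3 $ 3 = 0"
  "g_f $ 1 $ 1 = 0" "g_f $ 1 $ 2 = 0" "g_f $ 1 $ 3 = 1"
  "g_f $ 2 $ 1 = 1" "g_f $ 2 $ 2 = 0" "g_f $ 2 $ 3 = 0"
  "g_f $ 3 $ 1 = 0" "g_f $ 3 $ 2 = 0" "g_f $ 3 $ 3 = 0"
  by (simp_all add: g_z_def g_k_def g_k1_def g_k2_def g_e'_def g_f'_def g_p_def g_e_def g_f_def
        entries index_distinct del: vector_add_component vector_minus_component)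

lemma coord_basis: "i < 9 \<Longrightarrow> j < 9 \<Longrightarrow> coord i (basis j) = (if i = j then 1 else 0)"
  unfolding less_9_cases
  by (elim insertE emptyE) (simp_all add: coord_simps basis_simps basis_entries)

lemma gl12_expansion: "A = (\<Sum>j<9. gscale (coord j A) (basis j))"
  unfolding vec_eq_iff forall_3 lessThan_9
  by (simp add: coord_simps basis_simps entries basis_entries field_simps)

lemma homogeneous_iff:
  "homogeneous s A \<longleftrightarrow> (\<forall>i j. (parity i + parity j) mod 2 \<noteq> s \<longrightarrow> A $ i $ j = 0)"
  by (auto simp: homogeneous_def component_def vec_eq_iff)

lemma homogeneous_0_iff:
  "homogeneous 0 A \<longleftrightarrow> A$1$2 = 0 \<and> A$1$3 = 0 \<and> A$2$1 = 0 \<and> A$3$1 = 0"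
  unfolding homogeneous_iff forall_3 by (simp add: parity_def)

lemma homogeneous_1_iff:
  "homogeneous (Suc 0) A \<longleftrightarrow> A$1$1 = 0 \<and> A$2$2 = 0 \<and> A$2$3 = 0 \<and> A$3$2 = 0 \<and> A$3$3 = 0"
  unfolding homogeneous_iff forall_3 by (simp add: parity_def)

lemma homogeneous_basis: "i < 9 \<Longrightarrow> homogeneous (basis_parity i) (basis i)"
  unfolding less_9_cases
  by (elim insertE emptyE)
     (simp_all add: homogeneous_0_iff homogeneous_1_iff basis_parity_def basis_simps basis_entries)

text \<open>
  The basis is homogeneous, so an odd coordinate sees only the odd part of a matrix and an even
  one only the even part.
\<close>
lemma coord_homogeneous:
  assumes hom: "homogeneous s A" and nz: "coord i A \<noteq> 0" and s: "s \<in> {0,1}"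
  shows "basis_parity i = s"
proof -
  have i: "i \<in> {0,1,2,3,4,5,6,7,8}"
    using nz by (auto simp: coord_def split: if_splits)
  consider "s = 0" | "s = 1" using s by blast
  then show ?thesis
  proof cases
    case 1
    with hom have "A$1$2 = 0" "A$1$3 = 0" "A$2$1 = 0" "A$3$1 = 0"
      by (simp_all add: homogeneous_0_iff)
    with i nz 1 show ?thesis
      by (elim insertE emptyE) (simp_all add: basis_parity_def coord_def)
  next
    case 2
    with hom have "A$1$1 = 0" "A$2$2 = 0" "A$2$3 = 0" "A$3$2 = 0" "A$3$3 = 0"
      by (simp_all add: homogeneous_1_iff)
    with i nz 2 show ?thesis
      by (elim insertE emptyE) (simp_all add: basis_parity_def coord_def)
  qed
qed

lemma homogeneous_mult:
  assumes "homogeneous s A" "homogeneous t B"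
  shows "homogeneous ((s + t) mod 2) (A ** B)"
  unfolding homogeneous_iff
proof (intro allI impI)
  fix i j assume ne: "(parity i + parity j) mod 2 \<noteq> (s + t) mod 2"
  have "A $ i $ k * B $ k $ j = 0" for k
  proof (rule ccontr)
    assume "A $ i $ k * B $ k $ j \<noteq> 0"
    then have "(parity i + parity k) mod 2 = s" "(parity k + parity j) mod 2 = t"
      using assms by (auto simp: homogeneous_iff)
    then have "(s + t) mod 2 = (parity i + parity k + (parity k + parity j)) mod 2"
      by (metis mod_add_eq)
    also have "\<dots> = (parity i + parity j + 2 * parity k) mod 2" by (rule arg_cong[where f = "\<lambda>x. x mod 2"]) simp
    also have "\<dots> = (parity i + parity j) mod 2" by simp
    finally show False using ne by simp
  qed
  then show "(A ** B) $ i $ j = 0"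
    by (auto simp: matrix_matrix_mult_def intro!: sum.neutral)
qed

lemma gscale_one: "gscale 1 A = A"
  by (simp add: gscale_def vec_eq_iff)

lemma sbracket_homogeneous:
  assumes "homogeneous s A" "homogeneous t B" "s \<in> {0,1}" "t \<in> {0,1}"
  shows "sbracket A B = A ** B - gscale ((-1) ^ (s * t)) (B ** A)"
proof -
  have c: "component r C = (if r = q then C else 0)" if "homogeneous q C" for r q C
    using that by (auto simp: homogeneous_iff component_def vec_eq_iff)
  have "component r C = 0" if "homogeneous q C" "r \<noteq> q" for r q C
    using c[OF that(1)] that(2) by simp
  moreover have "gscale d 0 = 0" for d by (simp add: gscale_def vec_eq_iff)
  ultimately show ?thesis using assms unfolding sbracket_def
    by (auto simp: c[OF assms(1)] c[OF assms(2)] gscale_one)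
qed

lemma homogeneous_diff: "homogeneous s A \<Longrightarrow> homogeneous s B \<Longrightarrow> homogeneous s (A - B)"
  by (simp add: homogeneous_iff)

lemma homogeneous_gscale: "homogeneous s A \<Longrightarrow> homogeneous s (gscale c A)"
  by (simp add: homogeneous_iff gscale_def)

lemma homogeneous_sbracket:
  assumes "homogeneous s A" "homogeneous t B" "s \<in> {0,1}" "t \<in> {0,1}"
  shows "homogeneous ((s + t) mod 2) (sbracket A B)"
  unfolding sbracket_homogeneous[OF assms]
  using homogeneous_mult[OF assms(1,2)] homogeneous_mult[OF assms(2,1)]
  by (simp add: homogeneous_diff homogeneous_gscale add.commute)

section \<open>Tensor powers of the matrix algebra with a unit adjoined\<close>

text \<open>
  Labels of a basis of \<open>V = \<complex>1 \<oplus> M\<^sub>3(\<complex>)\<close>: \<open>None\<close> stands for the new unit, \<open>Some i\<close> for the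
  \<open>i\<close>-th basis matrix. The new unit is what makes the construction work: unlike the identity matrix, it
  is not in the image of \<open>gl(1|2)\<close>.
\<close>
definition slots :: "nat option set" where
  "slots = insert None (Some ` {..<9})"

definition slot_parity :: "nat option \<Rightarrow> nat" where
  "slot_parity a = (case a of None \<Rightarrow> 0 | Some i \<Rightarrow> basis_parity i)"

text \<open>
  The matrix of left multiplication by \<open>x\<close> on \<open>V\<close>. The row of \<open>None\<close> is zero because the matrices
  form an ideal of \<open>V\<close>.
\<close>
definition rho :: "gl12 \<Rightarrow> nat option \<Rightarrow> nat option \<Rightarrow> complex" where
  "rho x a b = (case a of None \<Rightarrow> 0 | Some i \<Rightarrow>
     (case b of None \<Rightarrow> coord i x | Some j \<Rightarrow> coord i (x ** basis j)))"

lemma gscale_mult_left: "gscale c A ** B = gscale c (A ** B)"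
  by (simp add: gscale_def matrix_matrix_mult_def vec_eq_iff sum_distrib_left mult.assoc)

lemma gscale_mult_right: "A ** gscale c B = gscale c (A ** B)"
  by (simp add: gscale_def matrix_matrix_mult_def vec_eq_iff sum_distrib_left mult_ac)

lemma coord_zero: "coord i 0 = 0"
  using coord_add[of i 0 0] by simp

lemma coord_sum: "coord i (\<Sum>j\<in>S. A j) = (\<Sum>j\<in>S. coord i (A j))"
  by (induction S rule: infinite_finite_induct) (simp_all add: coord_add coord_zero)

lemma matrix_mult_zero: "A ** 0 = (0 :: gl12)"
  by (simp add: matrix_matrix_mult_def vec_eq_iff)

lemma matrix_mult_sum_right: "A ** (\<Sum>j\<in>S. B j) = (\<Sum>j\<in>S. A ** (B j :: gl12))"
  by (induction S rule: infinite_finite_induct) (simp_all add: matrix_add_ldistrib matrix_mult_zero)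

lemma coord_mult_expand: "coord i (x ** y) = (\<Sum>j<9. coord i (x ** basis j) * coord j y)"
proof -
  have "coord i (x ** y) = coord i (x ** (\<Sum>j<9. gscale (coord j y) (basis j)))"
    using gl12_expansion[of y] by simp
  then show ?thesis
    by (simp add: matrix_mult_sum_right coord_sum gscale_mult_right coord_gscale mult.commute)
qed

lemma matrix_mult_add_left: "(A + B) ** C = A ** C + B ** (C :: gl12)"
  by (simp add: matrix_matrix_mult_def vec_eq_iff sum.distrib distrib_right)

lemma rho_add: "rho (x + y) a b = rho x a b + rho y a b"
  by (simp add: rho_def coord_add matrix_mult_add_left split: option.split)

lemma rho_gscale: "rho (gscale c x) a b = c * rho x a b"
  by (simp add: rho_def coord_gscale gscale_mult_left split: option.split)

lemma rho_diff: "rho (x - y) a b = rho x a b - rho y a b"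
  using rho_add[of "x - y" y a b] by simp

text \<open>
  Left multiplication is a homomorphism; in coordinates this is the expansion of \<open>y ** basis j\<close> in the
  basis. The summand \<open>b = None\<close> contributes nothing.
\<close>
lemma rho_mult: "rho (x ** y) a c = (\<Sum>b\<in>slots. rho x a b * rho y b c)"
proof -
  have "rho (x ** y) a c = (\<Sum>j<9. rho x a (Some j) * rho y (Some j) c)"
  proof (cases a)
    case (Some i)
    then show ?thesis
      by (cases c) (simp_all add: rho_def coord_mult_expand[of i x y]
          coord_mult_expand[of i x "y ** basis _"] flip: matrix_mul_assoc)
  qed (simp add: rho_def)
  also have "\<dots> = (\<Sum>b\<in>slots. rho x a b * rho y b c)"
    unfolding slots_def by (subst sum.insert) (auto simp: sum.reindex rho_def)
  finally show ?thesis .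
qed

lemma rho_parity:
  assumes "homogeneous s x" "s \<in> {0,1}" "rho x a b \<noteq> 0" "b \<in> slots"
  shows "slot_parity a = (s + slot_parity b) mod 2"
proof -
  obtain i where a: "a = Some i" using assms(3) by (cases a) (auto simp: rho_def)
  show ?thesis
  proof (cases b)
    case None
    with assms a coord_homogeneous[of s x i] show ?thesis
      by (auto simp: rho_def slot_parity_def)
  next
    case (Some j)
    then have "j < 9" using assms(4) by (auto simp: slots_def)
    from homogeneous_mult[OF assms(1) homogeneous_basis[OF this]]
    have "basis_parity i = (s + basis_parity j) mod 2"
      by (rule coord_homogeneous) (use assms(3) a Some in \<open>auto simp: rho_def\<close>)
    then show ?thesis using a Some by (simp add: slot_parity_def)
  qed
qed

text \<open>
  The super sign for moving \<open>x\<close> past a tensor factor with label \<open>a\<close>, extended linearly from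
  homogeneous \<open>x\<close>.
\<close>
definition twist :: "nat option \<Rightarrow> gl12 \<Rightarrow> gl12" where
  "twist a x = component 0 x + gscale ((-1) ^ slot_parity a) (component 1 x)"

lemma component_add: "component s (x + y) = component s x + component s y"
  by (simp add: component_def vec_eq_iff)

lemma component_gscale: "component s (gscale c x) = gscale c (component s x)"
  by (simp add: component_def gscale_def vec_eq_iff)

lemma twist_add: "twist a (x + y) = twist a x + twist a y"
  by (simp add: twist_def component_add gscale_def vec_eq_iff algebra_simps)

lemma twist_gscale: "twist a (gscale c x) = gscale c (twist a x)"
  by (simp add: twist_def component_gscale) (simp add: gscale_def vec_eq_iff algebra_simps)

lemma twist_homogeneous:
  assumes "homogeneous s x" "s \<in> {0,1}"
  shows "twist a x = gscale ((-1) ^ (s * slot_parity a)) x"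
proof -
  have "component r x = (if r = s then x else 0)" for r
    using assms(1) by (auto simp: homogeneous_iff component_def vec_eq_iff)
  then show ?thesis using assms(2)
    by (auto simp: twist_def gscale_def vec_eq_iff)
qed

lemma twist_None: "twist None x = x"
  by (simp add: twist_def slot_parity_def component_def gscale_def vec_eq_iff parity_def)

text \<open>
  A function on lists of labels is the coordinate array of a tensor. Writing
  \<open>x (v \<otimes> t) = xv \<otimes> t \<plusminus> v \<otimes> xt\<close> in coordinates gives this recursion, where all tensor powers are treated
  at once: the length of the list is the number of factors.
\<close>
primrec act_at :: "nat option list \<Rightarrow> gl12 \<Rightarrow> (nat option list \<Rightarrow> complex) \<Rightarrow> complex" where
  "act_at [] x f = 0"
| "act_at (a # l) x f = (\<Sum>b\<in>slots. rho x a b * f (b # l)) + act_at l (twist a x) (\<lambda>l'. f (a # l'))"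

definition act :: "gl12 \<Rightarrow> (nat option list \<Rightarrow> complex) \<Rightarrow> nat option list \<Rightarrow> complex" where
  "act x f = (\<lambda>l. act_at l x f)"

lemma act_at_add_left: "act_at l (x + y) f = act_at l x f + act_at l y f"
  by (induction l arbitrary: x y f) (simp_all add: rho_add twist_add sum.distrib algebra_simps)

lemma act_at_gscale: "act_at l (gscale c x) f = c * act_at l x f"
  by (induction l arbitrary: x f) (simp_all add: rho_gscale twist_gscale sum_distrib_left algebra_simps)

lemma act_at_add_right: "act_at l x (\<lambda>l. f l + g l) = act_at l x f + act_at l x g"
  by (induction l arbitrary: x f g) (simp_all add: sum.distrib algebra_simps)

lemma act_at_scale_right: "act_at l x (\<lambda>l. c * f l) = c * act_at l x f"
  by (induction l arbitrary: x f) (simp_all add: sum_distrib_left algebra_simps)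

lemma act_at_zero_right: "act_at l x (\<lambda>l. 0) = 0"
  using act_at_scale_right[of l x 0 "\<lambda>l. 0"] by simp

lemma act_at_sum_right: "act_at l x (\<lambda>l. \<Sum>i\<in>S. f i l) = (\<Sum>i\<in>S. act_at l x (f i))"
  by (induction S rule: infinite_finite_induct) (simp_all add: act_at_add_right act_at_zero_right)

text \<open>
  An operator of parity \<open>s\<close> maps label parity \<open>q\<close> to \<open>p\<close>. The lemma compares the signs that an element of
  parity \<open>t\<close> picks up before and after it.
\<close>
lemma sgn_cancel:
  assumes "(p::nat) = (s + q) mod 2" "s \<in> {0,1}" "t \<in> {0,1}" "q \<in> {0,1}"
  shows "(-1::complex) ^ (t * q) = (-1) ^ (s * t) * (-1) ^ (t * p)"
  using assms by auto

lemma slot_parity_01: "slot_parity a \<in> {0,1}"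
  by (auto simp: slot_parity_def basis_parity_def split: option.split)

text \<open>
  The super Leibniz rule is compatible with the bracket: in \<open>xy - (-1)\<^bsup>st\<^esup>yx\<close> the terms in which \<open>x\<close> and
  \<open>y\<close> act on different sides of the first tensor factor cancel, because \<open>x\<close> changes the parity of that factor by
  \<open>s\<close> and so reverses the sign of \<open>y\<close> exactly when \<open>(-1)\<^bsup>st\<^esup> = -1\<close>. What remains is the commutator on the first
  factor, which is \<open>rho\<close> of the bracket, and the commutator on the others, covered by induction.
\<close>
lemma act_super:
  assumes "homogeneous s x" "homogeneous t y" and st: "s \<in> {0,1}" "t \<in> {0,1}"
  shows "act_at l x (act y f) - (-1) ^ (s * t) * act_at l y (act x f) = act_at l (sbracket x y) f"
proof (induction l arbitrary: f)
  case Nil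
  then show ?case by simp
next
  case (Cons a l)
  \<comment> \<open>The second and third sums are the mixed terms. Exchanging \<open>x\<close> and \<open>y\<close> turns each into the other, up to the sign \<open>(-1)\<^bsup>st\<^esup>\<close>.\<close>
  have comp: "act_at (a # l) x (act y f)
      = (\<Sum>c\<in>slots. rho (x ** y) a c * f (c # l))
        + (-1) ^ (s * t) * (-1) ^ (t * slot_parity a) * (\<Sum>b\<in>slots. rho x a b * act_at l y (\<lambda>l'. f (b # l')))
        + (-1) ^ (s * slot_parity a) * (\<Sum>b\<in>slots. rho y a b * act_at l x (\<lambda>l'. f (b # l')))
        + (-1) ^ (s * slot_parity a) * (-1) ^ (t * slot_parity a) * act_at l x (act y (\<lambda>l'. f (a # l')))"
    if hom: "homogeneous s x" "homogeneous t y" and st: "s \<in> {0,1}" "t \<in> {0,1}" for x y s t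
  proof -
    have swap: "rho x a b * (-1) ^ (t * slot_parity b) = (-1) ^ (s * t) * (-1) ^ (t * slot_parity a) * rho x a b"
      if "b \<in> slots" for b
    proof (cases "rho x a b = 0")
      case False
      from sgn_cancel[OF rho_parity[OF hom(1) st(1) False that] st slot_parity_01] show ?thesis
        by simp
    qed simp
    have y: "act y f (b # l) = (\<Sum>c\<in>slots. rho y b c * f (c # l))
        + (-1) ^ (t * slot_parity b) * act_at l y (\<lambda>l'. f (b # l'))" for b l
      by (simp add: act_def twist_homogeneous[OF hom(2) st(2)] act_at_gscale)
    have "(\<Sum>b\<in>slots. rho x a b * act y f (b # l)) =
       (\<Sum>b\<in>slots. \<Sum>c\<in>slots. rho x a b * rho y b c * f (c # l))
       + (\<Sum>b\<in>slots. rho x a b * (-1) ^ (t * slot_parity b) * act_at l y (\<lambda>l'. f (b # l')))"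
      by (simp add: y distrib_left sum.distrib sum_distrib_left mult.assoc)
    also have "(\<Sum>b\<in>slots. \<Sum>c\<in>slots. rho x a b * rho y b c * f (c # l))
        = (\<Sum>c\<in>slots. rho (x ** y) a c * f (c # l))"
      by (subst sum.swap) (simp add: rho_mult sum_distrib_right)
    also have "(\<Sum>b\<in>slots. rho x a b * (-1) ^ (t * slot_parity b) * act_at l y (\<lambda>l'. f (b # l')))
        = (-1) ^ (s * t) * (-1) ^ (t * slot_parity a) * (\<Sum>b\<in>slots. rho x a b * act_at l y (\<lambda>l'. f (b # l')))"
      unfolding sum_distrib_left by (rule sum.cong) (simp_all add: swap mult.assoc)
    finally have 1: "(\<Sum>b\<in>slots. rho x a b * act y f (b # l)) =
       (\<Sum>c\<in>slots. rho (x ** y) a c * f (c # l)) +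
       (-1) ^ (s * t) * (-1) ^ (t * slot_parity a) * (\<Sum>b\<in>slots. rho x a b * act_at l y (\<lambda>l'. f (b # l')))" .
    have 2: "act_at l (twist a x) (\<lambda>l'. act y f (a # l')) = (-1) ^ (s * slot_parity a) *
        ((\<Sum>b\<in>slots. rho y a b * act_at l x (\<lambda>l'. f (b # l')))
         + (-1) ^ (t * slot_parity a) * act_at l x (act y (\<lambda>l'. f (a # l'))))"
      unfolding twist_homogeneous[OF hom(1) st(1)] act_at_gscale y
      by (simp add: act_at_add_right act_at_sum_right act_at_scale_right act_def)
    show ?thesis
      by (simp add: 1 2 algebra_simps)
  qed
  have sq: "(-1::complex) ^ (s * t) * (-1) ^ (s * t) = 1"
    by (simp flip: power_add mult_2)
  have ts: "(-1::complex) ^ (t * s) = (-1) ^ (s * t)" by (simp add: mult.commute)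
  have br: "act_at l x (act y (\<lambda>l'. f (a # l')))
      = (-1) ^ (s * t) * act_at l y (act x (\<lambda>l'. f (a # l')))
        + act_at l (sbracket x y) (\<lambda>l'. f (a # l'))"
    using Cons.IH[of "\<lambda>l'. f (a # l')"] by (simp add: algebra_simps)
  have tw: "act_at l (twist a (sbracket x y)) g
     = (-1) ^ (s * slot_parity a) * (-1) ^ (t * slot_parity a) * act_at l (sbracket x y) g" for g
  proof -
    have "(-1::complex) ^ ((s + t) mod 2 * slot_parity a) = (-1) ^ (s * slot_parity a) * (-1) ^ (t * slot_parity a)"
      using st by (auto simp flip: power_add mult_2)
    moreover have "(s + t) mod 2 \<in> {0,1}" by auto
    ultimately show ?thesis
      by (simp add: twist_homogeneous[OF homogeneous_sbracket[OF assms]] act_at_gscale)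
  qed
  have rb: "(\<Sum>c\<in>slots. rho (sbracket x y) a c * f (c # l)) =
      (\<Sum>c\<in>slots. rho (x ** y) a c * f (c # l)) - (-1) ^ (s * t) * (\<Sum>c\<in>slots. rho (y ** x) a c * f (c # l))"
    by (simp add: sbracket_homogeneous[OF assms] rho_diff rho_gscale left_diff_distrib
        sum_subtractf sum_distrib_left mult.assoc)
  have c1: "(-1) ^ (s * t) * ((-1) ^ (s * t) * u) = (u :: complex)" for u
    using sq by (simp flip: mult.assoc)
  have rhs: "act_at (a # l) (sbracket x y) f =
      (\<Sum>c\<in>slots. rho (x ** y) a c * f (c # l)) - (-1) ^ (s * t) * (\<Sum>c\<in>slots. rho (y ** x) a c * f (c # l))
      + (-1) ^ (s * slot_parity a) * (-1) ^ (t * slot_parity a) * act_at l (sbracket x y) (\<lambda>l'. f (a # l'))"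
    by (simp only: act_at.simps rb tw)
  show ?case
    unfolding comp[OF assms] comp[OF assms(2,1) st(2,1)] ts rhs br
    by (simp add: algebra_simps c1)
qed

section \<open>The action of the enveloping algebra\<close>

definition act_word :: "gl12 list \<Rightarrow> (nat option list \<Rightarrow> complex) \<Rightarrow> nat option list \<Rightarrow> complex" where
  "act_word w f = foldr act w f"

lemma act_word_simps [simp]:
  "act_word [] f = f" "act_word (x # w) f = act x (act_word w f)"
  by (simp_all add: act_word_def)

lemma act_word_append: "act_word (v @ w) f = act_word v (act_word w f)"
  by (simp add: act_word_def)

lemma act_word_add: "act_word w (\<lambda>l. f l + g l) = (\<lambda>l. act_word w f l + act_word w g l)"
  by (induction w) (simp_all add: act_def act_at_add_right)

lemma act_word_scale: "act_word w (\<lambda>l. c * f l) = (\<lambda>l. c * act_word w f l)"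
  by (induction w) (simp_all add: act_def act_at_scale_right)

definition act_free :: "free_alg \<Rightarrow> (nat option list \<Rightarrow> complex) \<Rightarrow> nat option list \<Rightarrow> complex" where
  "act_free u f l = (\<Sum>w\<in>Poly_Mapping.keys u. Poly_Mapping.lookup u w * act_word w f l)"

lemma act_free_superset:
  assumes "finite S" "Poly_Mapping.keys u \<subseteq> S"
  shows "act_free u f l = (\<Sum>w\<in>S. Poly_Mapping.lookup u w * act_word w f l)"
  unfolding act_free_def
  by (rule sum.mono_neutral_left) (use assms in \<open>auto simp: in_keys_iff\<close>)

lemma act_free_add: "act_free (u + v) f l = act_free u f l + act_free v f l"
proof -
  let ?S = "Poly_Mapping.keys u \<union> Poly_Mapping.keys v"
  have "Poly_Mapping.keys (u + v) \<subseteq> ?S" by (rule Poly_Mapping.keys_add)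
  then show ?thesis
    by (simp add: act_free_superset[of ?S] lookup_add distrib_right sum.distrib)
qed

lemma act_free_single: "act_free (Poly_Mapping.single w c) f l = c * act_word w f l"
  by (subst act_free_superset[of "{w}"]) auto

lemma act_free_zero: "act_free 0 f l = 0"
  by (simp add: act_free_def)

lemma act_free_diff: "act_free (u - v) f l = act_free u f l - act_free v f l"
  using act_free_add[of "u - v" v f l] by simp

lemma act_free_linear:
  "act_free u (\<lambda>l. f l + g l) l = act_free u f l + act_free u g l"
  "act_free u (\<lambda>l. c * f l) l = c * act_free u f l"
  by (simp_all add: act_free_def act_word_add act_word_scale distrib_left sum.distrib
      sum_distrib_left mult_ac)

lemma act_free_mult: "act_free (u * v) f l = act_free u (act_free v f) l"
proof (induction u arbitrary: l rule: poly_mapping_induct)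
  case (single w c)
  show ?case
  proof (induction v arbitrary: l rule: poly_mapping_induct)
    case (single w' c')
    have "act_free (Poly_Mapping.single w' c') f = (\<lambda>l. c' * act_word w' f l)"
      by (simp add: act_free_single fun_eq_iff)
    then show ?case
      by (simp add: mult_single plus_list_def act_free_single act_word_append act_word_scale mult_ac)
  next
    case (add u v)
    then show ?case
      by (simp add: distrib_left act_free_add act_free_single act_word_add)
  qed
next
  case (add u v)
  then show ?case by (simp add: distrib_right act_free_add)
qed

lemma act_free_gen: "act_free (gen x) f = act x f"
  by (simp add: gen_def act_free_single fun_eq_iff)

lemma act_free_const: "act_free (const c) f l = c * f l"
  by (simp add: const_def act_free_single)

text \<open>
  The relations hold for the action on every tensor, so the two-sided ideal acts as zero and the
  action descends to the enveloping algebra.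
\<close>
lemma act_free_env_ideal: "u \<in> env_ideal \<Longrightarrow> act_free u f l = 0"
proof (induction arbitrary: f l rule: env_ideal.induct)
  case (super s x t y)
  then show ?case
    using act_super[of s x t y l f]
    by (simp add: act_free_diff act_free_mult act_free_gen act_free_const)
       (simp add: act_def)
next
  case (left a u)
  then have "act_free a f = (\<lambda>l. 0 * f l)" for f by (simp add: fun_eq_iff)
  then show ?case by (simp only: act_free_mult act_free_linear) simp
next
  case (right a u)
  then show ?case by (simp add: act_free_mult)
qed (simp_all add: act_free_diff act_free_add act_free_gen act_free_mult act_free_const act_free_zero
    act_def act_at_add_left act_at_gscale)

text \<open>
  The coordinates of \<open>1 \<otimes> \<dots> \<otimes> 1\<close>, for every number of factors.
\<close>
definition vac :: "nat option list \<Rightarrow> complex" where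
  "vac l = (if set l \<subseteq> {None} then 1 else 0)"

text \<open>
  The coordinate at \<open>l\<close> of \<open>u (1 \<otimes> \<dots> \<otimes> 1)\<close>, a linear functional on the enveloping algebra.
\<close>
lift_definition coeff_at :: "nat option list \<Rightarrow> uea \<Rightarrow> complex" is "\<lambda>l u. act_free u vac l"
proof -
  fix l u v assume "env_rel u v"
  then have "act_free (u - v) vac l = 0"
    unfolding env_rel_def by (rule act_free_env_ideal)
  then show "act_free u vac l = act_free v vac l" by (simp add: act_free_diff)
qed

lemma coeff_at_add: "coeff_at l (u + v) = coeff_at l u + coeff_at l v"
  by transfer (simp add: act_free_add)

lemma coeff_at_scale: "coeff_at l (uscale c u) = c * coeff_at l u"
  by transfer (simp add: act_free_mult act_free_const)

lemma coeff_at_sum: "coeff_at l (\<Sum>i\<in>S. u i) = (\<Sum>i\<in>S. coeff_at l (u i))"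
proof (induction S rule: infinite_finite_induct)
  have "coeff_at l 0 = 0" by transfer (simp add: act_free_zero)
  then show "coeff_at l (sum u {}) = (\<Sum>i\<in>{}. coeff_at l (u i))"
    "infinite A \<Longrightarrow> coeff_at l (sum u A) = (\<Sum>i\<in>A. coeff_at l (u i))" for A
    by simp_all
qed (simp add: coeff_at_add)

definition word_prod :: "nat list \<Rightarrow> uea" where
  "word_prod w = prod_list (map (\<lambda>i. \<iota> (basis i)) w)"

lemma coeff_at_word_prod: "coeff_at l (word_prod w) = act_word (map basis w) vac l"
proof -
  define fw where "fw = prod_list (map (\<lambda>i. gen (basis i)) w)"
  have 1: "abs_uea fw = word_prod w"
    unfolding fw_def word_prod_def
  proof (induction w)
    case Nil
    then show ?case by (simp add: one_uea.abs_eq)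
  next
    case (Cons i w)
    then show ?case by (simp add: times_uea.abs_eq[symmetric] \<iota>.abs_eq)
  qed
  have 2: "fw = Poly_Mapping.single (map basis w) 1" unfolding fw_def
  proof (induction w)
    case Nil
    then show ?case by (simp add: const_1[unfolded const_def])
  qed (simp add: gen_def mult_single plus_list_def)
  show ?thesis
    unfolding 1[symmetric] coeff_at.abs_eq by (simp add: 2 act_free_single)
qed

section \<open>Independence of the ordered monomials\<close>

text \<open>
  The number of tensor factors that lie in the matrix part of \<open>V\<close>. Each letter of a monomial raises it
  by at most one, which bounds the degree from below.
\<close>
definition num_some :: "nat option list \<Rightarrow> nat" where
  "num_some l = length (filter (\<lambda>a. a \<noteq> None) l)"

lemma num_some_simps [simp]: "num_some [] = 0" "num_some (None # l) = num_some l" "num_some (Some i # l) = Suc (num_some l)"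
  "num_some (map Some w) = length w"
  by (simp_all add: num_some_def)

lemma vac_None: "vac (None # l) = vac l" by (simp add: vac_def)
lemma vac_Some: "vac (Some i # l) = 0" by (simp add: vac_def)

text \<open>
  An element of the Lie superalgebra changes one tensor factor only, hence the result at \<open>l\<close> depends
  only on coordinates that have at most one matrix factor less.
\<close>
lemma act_at_cong:
  assumes "\<And>l'. num_some l \<le> Suc (num_some l') \<Longrightarrow> f l' = g l'"
  shows "act_at l x f = act_at l x g"
  using assms
proof (induction l arbitrary: x f g)
  case (Cons a l)
  show ?case
  proof (cases a)
    case None
    have "act_at l (twist a x) (\<lambda>l'. f (a # l')) = act_at l (twist a x) (\<lambda>l'. g (a # l'))"
      by (rule Cons.IH) (use Cons.prems None in auto)
    then show ?thesis by (simp add: None rho_def)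
  next
    case (Some i)
    have "act_at l (twist a x) (\<lambda>l'. f (a # l')) = act_at l (twist a x) (\<lambda>l'. g (a # l'))"
      by (rule Cons.IH) (use Cons.prems Some in auto)
    moreover have "f (b # l) = g (b # l)" for b
      by (rule Cons.prems) (cases b; simp add: Some)
    ultimately show ?thesis by simp
  qed
qed simp

text \<open>
  A factor that is still the unit has been left alone by all letters, so it can be dropped.
\<close>
lemma act_word_None: "act_word w vac (None # l) = act_word w vac l"
proof (induction w arbitrary: l)
  case (Cons x w)
  then show ?case by (simp add: act_def rho_def twist_None)
qed (simp add: vac_None)

lemma act_word_short: "length w < num_some l \<Longrightarrow> act_word w vac l = 0"
proof (induction w arbitrary: l)
  case Nil
  then show ?case by (auto simp: vac_def num_some_def filter_empty_conv split: if_splits)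
next
  case (Cons x w)
  have "act_at l x (act_word w vac) = act_at l x (\<lambda>l. 0)"
    by (rule act_at_cong) (use Cons in auto)
  then show ?case by (simp add: act_def act_at_zero_right)
qed

text \<open>
  For summing over the letter that acts on a given tensor factor. The letters in front of it are kept apart
  because they determine the sign.
\<close>
fun deletions :: "'a list \<Rightarrow> ('a list \<times> 'a \<times> 'a list) list" where
  "deletions [] = []"
| "deletions (x # w) = ([], x, w) # map (\<lambda>(u, y, v). (x # u, y, v)) (deletions w)"

text \<open>
  The symbol of a monomial. When there are at least as many matrix factors as letters, the first factor
  must be reached by exactly one letter \<open>y\<close>, and then it equals \<open>y1 = y\<close>. The letters in front of \<open>y\<close> have to
  move past this factor, which produces their twist.
\<close>
lemma act_word_Some:
  assumes "length w \<le> Suc (num_some l)"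
  shows "act_word w vac (Some i # l) =
    (\<Sum>(u, y, v)\<leftarrow>deletions w. coord i y * act_word (map (twist (Some i)) u @ v) vac l)"
  using assms
proof (induction w arbitrary: l)
  case Nil
  then show ?case by (simp add: vac_Some)
next
  case (Cons x w)
  have "(\<Sum>b\<in>slots. rho x (Some i) b * act_word w vac (b # l))
     = (\<Sum>b\<in>{None}. rho x (Some i) b * act_word w vac (b # l))"
  proof (rule sum.mono_neutral_right)
    show "\<forall>b\<in>slots - {None}. rho x (Some i) b * act_word w vac (b # l) = 0"
      using Cons.prems by (auto simp: act_word_short)
  qed (auto simp: slots_def)
  also have "\<dots> = coord i x * act_word w vac l"
    by (simp add: rho_def act_word_None)
  finally have 1: "(\<Sum>b\<in>slots. rho x (Some i) b * act_word w vac (b # l)) = coord i x * act_word w vac l" .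
  let ?g = "\<lambda>l. \<Sum>(u, y, v)\<leftarrow>deletions w. coord i y * act_word (map (twist (Some i)) u @ v) vac l"
  have "act_at l (twist (Some i) x) (\<lambda>l'. act_word w vac (Some i # l')) = act_at l (twist (Some i) x) ?g"
    by (rule act_at_cong) (use Cons in auto)
  also have "act_at l z (\<lambda>l. \<Sum>(u, y, v)\<leftarrow>D. coord i y * act_word (map (twist (Some i)) u @ v) vac l)
     = (\<Sum>(u, y, v)\<leftarrow>D. coord i y * act_word (z # map (twist (Some i)) u @ v) vac l)" for z D
    by (induction D) (auto simp: act_at_add_right act_at_scale_right act_at_zero_right act_def split: prod.splits)
  finally have 2: "act_at l (twist (Some i) x) (\<lambda>l'. act_word w vac (Some i # l')) =
    (\<Sum>(u, y, v)\<leftarrow>deletions w. coord i y * act_word (twist (Some i) x # map (twist (Some i)) u @ v) vac l)" .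
  have "(\<Sum>t\<leftarrow>deletions w. (case t of (u, y, v) \<Rightarrow> coord i y * act_word (twist (Some i) x # map (twist (Some i)) u @ v) vac l))
      = (\<Sum>t\<leftarrow>map (\<lambda>(u, y, v). (x # u, y, v)) (deletions w). case t of (u, y, v) \<Rightarrow> coord i y * act_word (map (twist (Some i)) u @ v) vac l)"
    by (simp add: o_def case_prod_unfold)
  with 1 2 show ?case by (simp add: act_def)
qed

lemma set_deletions: "(u, y, v) \<in> set (deletions w) \<longleftrightarrow> w = u @ y # v"
proof (induction w arbitrary: u)
  case (Cons x w)
  have "(u, y, v) \<in> (\<lambda>(u, y, v). (x # u, y, v)) ` D \<longleftrightarrow> (\<exists>u'. u = x # u' \<and> (u', y, v) \<in> D)" for D
    by force
  then show ?case by (auto simp: Cons.IH Cons_eq_append_conv)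
qed simp

lemma deletions_map:
  "deletions (map g w) = map (\<lambda>(u, y, v). (map g u, g y, map g v)) (deletions w)"
  by (induction w) auto

lemma act_word_twist:
  assumes "set u \<subseteq> {..<9}"
  shows "act_word (map (twist a) (map basis u) @ v) f l
    = (-1) ^ (sum_list (map basis_parity u) * slot_parity a) * act_word (map basis u @ v) f l"
  using assms
proof (induction u arbitrary: l)
  case (Cons i u)
  then have "act_word (map (twist a) (map basis u) @ v) f
      = (\<lambda>l. (-1) ^ (sum_list (map basis_parity u) * slot_parity a) * act_word (map basis u @ v) f l)"
    by (auto simp: fun_eq_iff)
  moreover have "twist a (basis i) = gscale ((-1) ^ (basis_parity i * slot_parity a)) (basis i)"
    using Cons.prems by (intro twist_homogeneous homogeneous_basis) (auto simp: basis_parity_def)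
  ultimately show ?case
    by (simp add: act_def act_at_scale_right act_at_gscale del: map_map)
       (simp add: power_add distrib_right)
qed simp

text \<open>
  The coordinate, labelled by the letters of \<open>v\<close>, of the monomial \<open>w\<close> applied to
  \<open>1 \<otimes> \<dots> \<otimes> 1\<close>. It is used for \<open>length w \<le> length v\<close>.
\<close>
definition pairing :: "nat list \<Rightarrow> nat list \<Rightarrow> complex" where
  "pairing v w = coeff_at (map Some v) (word_prod w)"

lemma pairing_Cons:
  assumes "set w \<subseteq> {..<9}" "j < 9" "length w \<le> Suc (length v)"
  shows "pairing (j # v) w = (\<Sum>(u, y, u')\<leftarrow>deletions w.
    if y = j then (-1) ^ (sum_list (map basis_parity u) * basis_parity j) * pairing v (u @ u') else 0)"
proof -
  have "pairing (j # v) w = (\<Sum>(u, y, u')\<leftarrow>deletions w. coord j (basis y) *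
     act_word (map (twist (Some j)) (map basis u) @ map basis u') vac (map Some v))"
    unfolding pairing_def coeff_at_word_prod using assms(3)
    by (simp add: act_word_Some deletions_map o_def case_prod_unfold)
  also have "\<dots> = (\<Sum>(u, y, u')\<leftarrow>deletions w.
    if y = j then (-1) ^ (sum_list (map basis_parity u) * basis_parity j) * pairing v (u @ u') else 0)"
  proof (rule arg_cong[where f = sum_list], rule map_cong[OF refl], clarify)
    fix u y u' assume "(u, y, u') \<in> set (deletions w)"
    then have w: "w = u @ y # u'" by (simp add: set_deletions)
    have "coord j (basis y) = (if y = j then 1 else 0)"
      using assms w by (auto simp: coord_basis)
    moreover have "set u \<subseteq> {..<9}" using assms w by auto
    ultimately show "coord j (basis y) * act_word (map (twist (Some j)) (map basis u) @ map basis u') vac (map Some v)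
       = (if y = j then (-1) ^ (sum_list (map basis_parity u) * basis_parity j) * pairing v (u @ u') else 0)"
      by (simp add: act_word_twist pairing_def coeff_at_word_prod slot_parity_def del: map_map)
  qed
  finally show ?thesis .
qed

lemma pairing_zero:
  assumes "set w \<subseteq> {..<9}" "set v \<subseteq> {..<9}" "length w \<le> length v" "mset w \<noteq> mset v"
  shows "pairing v w = 0"
  using assms
proof (induction v arbitrary: w)
  case (Cons j v)
  have "(case t of (u, y, u') \<Rightarrow>
      if y = j then (-1) ^ (sum_list (map basis_parity u) * basis_parity j) * pairing v (u @ u') else 0) = 0"
    if "t \<in> set (deletions w)" for t
  proof -
    obtain u y u' where t: "t = (u, y, u')" by (cases t)
    then have w: "w = u @ y # u'" using that by (simp add: set_deletions)
    have "pairing v (u @ u') = 0" if "y = j"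
      by (rule Cons.IH) (use Cons.prems w that in auto)
    then show ?thesis by (simp add: t)
  qed
  then have "(\<Sum>(u, y, u')\<leftarrow>deletions w.
      if y = j then (-1) ^ (sum_list (map basis_parity u) * basis_parity j) * pairing v (u @ u') else 0)
    = (\<Sum>_\<leftarrow>deletions w. 0)"
    by (intro arg_cong[where f = sum_list] map_cong) auto
  with Cons.prems show ?case by (subst pairing_Cons) simp_all
qed simp

text \<open>
  The words of the PBW monomials. An odd letter is not repeated, because its square is a combination of
  single letters.
\<close>
definition ordered_words :: "nat set \<Rightarrow> nat list set" where
  "ordered_words I = {w. sorted w \<and> set w \<subseteq> I \<and> (\<forall>i. basis_parity i = 1 \<longrightarrow> count_list w i \<le> 1)}"

lemma sorted_mset_eqI: "sorted v \<Longrightarrow> sorted w \<Longrightarrow> mset v = mset w \<Longrightarrow> v = w"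
  using properties_for_sort[of w v] sorted_sort_id[of v] by simp

lemma ordered_words_eqI: "v \<in> ordered_words I \<Longrightarrow> w \<in> ordered_words I \<Longrightarrow> mset v = mset w \<Longrightarrow> v = w"
  by (rule sorted_mset_eqI) (auto simp: ordered_words_def)

text \<open>
  Deleting an occurrence of the least letter \<open>j\<close> from an ordered word always leaves the same word. If \<open>j\<close> is
  even there is no sign. If \<open>j\<close> is odd it occurs once, at the front, where the sign is trivial. So no
  cancellation is possible, and the pairing is the product of the factorials of the multiplicities.
\<close>
lemma pairing_self:
  assumes "w \<in> ordered_words {..<9}"
  shows "\<exists>c>0. pairing w w = of_nat c"
  using assms
proof (induction w)
  case Nil
  have "pairing [] [] = of_nat 1"
    by (simp add: pairing_def coeff_at_word_prod vac_def)
  then show ?case by (metis zero_less_one)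
next
  case (Cons j w)
  then have red: "w \<in> ordered_words {..<9}" by (auto simp: ordered_words_def split: if_splits)
  then obtain c where c: "c > 0" "pairing w w = of_nat c" using Cons.IH by blast
  \<comment> \<open>Every occurrence of \<open>j\<close> contributes the same number, without sign.\<close>
  have summand: "(case t of (u, y, u') \<Rightarrow>
      if y = j then (-1) ^ (sum_list (map basis_parity u) * basis_parity j) * pairing w (u @ u') else 0) =
      (if fst (snd t) = j then of_nat c else 0)"
    if "t \<in> set (deletions (j # w))" for t
  proof -
    obtain u y u' where t: "t = (u, y, u')" by (cases t)
    then have w: "j # w = u @ y # u'" using that by (simp only: set_deletions)
    show ?thesis
    proof (cases "y = j")
      case True
      have srt: "sorted (j # w)" using Cons.prems by (simp add: ordered_words_def)
      have "sorted (u @ u')" using srt unfolding w by (auto simp: sorted_append)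
      moreover have "mset (u @ u') = mset w"
        using arg_cong[OF w, of mset] True by simp
      moreover have "sorted w" using srt by simp
      ultimately have eq: "u @ u' = w" by (intro sorted_mset_eqI)
      have sign: "(-1 :: complex) ^ (sum_list (map basis_parity u) * basis_parity j) = 1"
      proof (cases "basis_parity j = 1")
        case odd: True
        then have "count_list (j # w) j \<le> 1" using Cons.prems unfolding ordered_words_def by blast
        then have "j \<notin> set u" unfolding w using True by (auto simp: count_list_0_iff)
        moreover have "hd (u @ y # u') = j" by (simp flip: w)
        ultimately have "u = []" by (cases u) auto
        then show ?thesis by simp
      qed (auto simp: basis_parity_def split: if_splits)
      then show ?thesis by (simp add: t True eq c sign)
    qed (simp add: t)
  qed
  have "pairing (j # w) (j # w) = (\<Sum>(u, y, u')\<leftarrow>deletions (j # w).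
      if y = j then (-1) ^ (sum_list (map basis_parity u) * basis_parity j) * pairing w (u @ u') else 0)"
    by (rule pairing_Cons) (use Cons.prems in \<open>auto simp: ordered_words_def\<close>)
  also have "\<dots> = (\<Sum>t\<leftarrow>deletions (j # w). if fst (snd t) = j then of_nat c else 0)"
    by (rule arg_cong[where f = sum_list], rule map_cong[OF refl], rule summand)
  also have "\<dots> = of_nat (c * length (filter (\<lambda>t. fst (snd t) = j) (deletions (j # w))))"
  proof -
    have "(\<Sum>t\<leftarrow>D. if fst (snd t) = j then of_nat c else 0) = (of_nat (c * length (filter (\<lambda>t. fst (snd t) = j) D)) :: complex)"
      for D :: "(nat list \<times> nat \<times> nat list) list"
      by (induction D) (auto simp: algebra_simps)
    then show ?thesis .
  qed
  finally show ?case using c(1) by (intro exI[of _ "c * length (filter (\<lambda>t. fst (snd t) = j) (deletions (j # w)))"]) simp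
qed

lemma family_independent:
  assumes "\<And>S c. finite S \<Longrightarrow> S \<subseteq> I \<Longrightarrow> (\<Sum>i\<in>S. uscale (c i) (v i)) = 0 \<Longrightarrow> \<forall>i\<in>S. c i = 0"
  shows "inj_on v I \<and> uea.independent (v ` I)"
proof
  show inj: "inj_on v I"
  proof (rule inj_onI, rule ccontr)
    fix i j assume ij: "i \<in> I" "j \<in> I" "v i = v j" "i \<noteq> j"
    have "(\<Sum>k\<in>{i, j}. uscale (if k = i then 1 else -1) (v k)) = 0"
      using ij by simp
    from assms[OF _ _ this] ij show False by auto
  qed
  show "uea.independent (v ` I)"
    unfolding uea.dependent_explicit
  proof clarify
    fix t u x assume t: "finite t" "t \<subseteq> v ` I" "(\<Sum>y\<in>t. uscale (u y) y) = 0" "x \<in> t" "u x \<noteq> 0"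
    from t(2) obtain S where S: "S \<subseteq> I" "inj_on v S" "t = v ` S"
      by (metis subset_image_inj)
    then have "finite S" "(\<Sum>i\<in>S. uscale (u (v i)) (v i)) = 0"
      using t(1,3) by (auto simp: sum.reindex dest: finite_imageD)
    from assms[OF this(1) S(1) this(2)] show False using t(4,5) S(3) by auto
  qed
qed

text \<open>
  In a linear relation take a monomial \<open>v\<close> of greatest length with non-zero coefficient. Pairing with \<open>v\<close>
  kills all other terms: they are not longer than \<open>v\<close>, and they have different letters, as an ordered word
  is determined by its multiset of letters.
\<close>
theorem pbw_independent: "inj_on word_prod (ordered_words {..<9}) \<and> uea.independent (word_prod ` ordered_words {..<9})"
proof (rule family_independent, rule ccontr)
  fix S c assume S: "finite S" "S \<subseteq> ordered_words {..<9}" "(\<Sum>w\<in>S. uscale (c w) (word_prod w)) = 0"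
    and "\<not> (\<forall>w\<in>S. c w = 0)"
  then have fin: "finite {w \<in> S. c w \<noteq> 0}" and "{w \<in> S. c w \<noteq> 0} \<noteq> {}" by auto
  then have "Max (length ` {w \<in> S. c w \<noteq> 0}) \<in> length ` {w \<in> S. c w \<noteq> 0}"
    by (intro Max_in) auto
  then obtain v where "v \<in> {w \<in> S. c w \<noteq> 0}" "Max (length ` {w \<in> S. c w \<noteq> 0}) = length v"
    by (rule imageE)
  then have v: "v \<in> S" "c v \<noteq> 0" "length v = Max (length ` {w \<in> S. c w \<noteq> 0})" by auto
  have le: "length w \<le> length v" if "w \<in> S" "c w \<noteq> 0" for w
    unfolding v(3)
  proof (rule Max_ge)
    show "length w \<in> length ` {w \<in> S. c w \<noteq> 0}" using that by (intro imageI) simp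
  qed (rule finite_imageI[OF fin])
  have "c w * pairing v w = 0" if w: "w \<in> S - {v}" for w
  proof (cases "c w = 0")
    case False
    have "mset w \<noteq> mset v"
      using w v(1) S(2) ordered_words_eqI by blast
    then have "pairing v w = 0"
      using w v(1) S(2) le[of w] False by (intro pairing_zero) (auto simp: ordered_words_def)
    then show ?thesis by simp
  qed simp
  then have "(\<Sum>w\<in>S. c w * pairing v w) = c v * pairing v v"
    by (subst sum.remove[OF S(1) v(1)], subst sum.neutral) simp_all
  moreover have "(\<Sum>w\<in>S. c w * pairing v w) = coeff_at (map Some v) 0"
    unfolding S(3)[symmetric] by (simp add: coeff_at_sum coeff_at_scale pairing_def)
  moreover have "coeff_at (map Some v) 0 = 0"
    using coeff_at_sum[of "map Some v" "\<lambda>_. 0" "{}"] by simp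
  ultimately have "pairing v v = 0" using v(2) by simp
  moreover have "v \<in> ordered_words {..<9}" using S(2) v(1) by blast
  ultimately show False using pairing_self by fastforce
qed

section \<open>Straightening\<close>

lemma word_prod_simps [simp]: "word_prod [] = 1" "word_prod (i # w) = \<iota> (basis i) * word_prod w"
  by (simp_all add: word_prod_def)

lemma word_prod_append: "word_prod (v @ w) = word_prod v * word_prod w"
  by (simp add: word_prod_def)

lemma span_mult_left:
  assumes "\<And>y. y \<in> B \<Longrightarrow> x * y \<in> uea.span C" "y \<in> uea.span B"
  shows "x * y \<in> uea.span C"
  using assms(2)
proof (induction rule: uea.span_induct_alt)
  case (step c y z)
  then show ?case
    using assms(1) by (simp add: distrib_left uea.span_add uea.span_scale flip: uscale_mult_right)
qed (simp add: uea.span_zero)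

lemma span_mult_right:
  assumes "\<And>y. y \<in> B \<Longrightarrow> y * x \<in> uea.span C" "y \<in> uea.span B"
  shows "y * x \<in> uea.span C"
  using assms(2)
proof (induction rule: uea.span_induct_alt)
  case (step c y z)
  then show ?case
    using assms(1) by (simp add: distrib_right uea.span_add uea.span_scale flip: uscale_mult_left)
qed (simp add: uea.span_zero)

text \<open>
  The letters in \<open>I\<close> span a Lie sub-superalgebra. The brackets have no constant term, so straightening a
  non-empty word never produces the empty one; this is what keeps the straightened words in \<open>\<kk>U\<close>.
\<close>
definition bracket_closed :: "nat set \<Rightarrow> bool" where
  "bracket_closed I \<longleftrightarrow> I \<subseteq> {..<9} \<and>
     (\<forall>i\<in>I. \<forall>j\<in>I. \<iota> (sbracket (basis i) (basis j)) \<in> uea.span (word_prod ` {[k] | k. k \<in> I}))"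

definition short_words :: "nat set \<Rightarrow> nat \<Rightarrow> nat list set" where
  "short_words I n = {w. set w \<subseteq> I \<and> w \<noteq> [] \<and> length w \<le> n}"

lemma short_mult:
  assumes "x \<in> uea.span (word_prod ` {[k] | k. k \<in> I})" "set v \<subseteq> I" "length v < n"
  shows "x * word_prod v \<in> uea.span (word_prod ` short_words I n)"
  by (rule span_mult_right[OF _ assms(1)])
     (use assms(2,3) in \<open>auto simp: short_words_def intro!: uea.span_base rev_image_eqI[of "_ # v"]\<close>)

lemma short_Cons:
  assumes "y \<in> uea.span (word_prod ` short_words I n)" "i \<in> I"
  shows "\<iota> (basis i) * y \<in> uea.span (word_prod ` short_words I (Suc n))"
  by (rule span_mult_left[OF _ assms(1)])
     (use assms(2) in \<open>auto simp: short_words_def intro!: uea.span_base rev_image_eqI[of "i # _"]\<close>)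

lemma basis_super:
  assumes "i < 9" "j < 9"
  shows "\<iota> (basis i) * \<iota> (basis j) =
    uscale ((-1) ^ (basis_parity i * basis_parity j)) (\<iota> (basis j) * \<iota> (basis i)) + \<iota> (sbracket (basis i) (basis j))"
  using \<iota>_super[OF homogeneous_basis[OF assms(1)] homogeneous_basis[OF assms(2)]]
  by (auto simp: basis_parity_def algebra_simps)

text \<open>
  Exchanging two adjacent letters costs a sign and a shorter word, so inserting a letter at its place
  does not change a monomial, up to a scalar and shorter words.
\<close>
lemma word_prod_insort:
  assumes I: "bracket_closed I" and "i \<in> I" "set v \<subseteq> I"
  shows "\<exists>s. word_prod (i # v) - uscale s (word_prod (insort i v)) \<in> uea.span (word_prod ` short_words I (length v))"
  using assms(3)
proof (induction v)
  case Nil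
  have "word_prod [i] - uscale 1 (word_prod (insort i [])) = 0" by simp
  then show ?case by (metis uea.span_zero)
next
  case (Cons j v)
  show ?case
  proof (cases "i \<le> j")
    case True
    then have "word_prod (i # j # v) - uscale 1 (word_prod (insort i (j # v))) = 0" by simp
    then show ?thesis by (metis uea.span_zero)
  next
    case False
    from Cons obtain s where s: "word_prod (i # v) - uscale s (word_prod (insort i v)) \<in> uea.span (word_prod ` short_words I (length v))"
      by auto
    let ?e = "(-1) ^ (basis_parity i * basis_parity j) :: complex"
    have ij: "i < 9" "j < 9" "j \<in> I" using I assms(2) Cons.prems by (auto simp: bracket_closed_def)
    have eq: "word_prod (i # j # v) - uscale (?e * s) (word_prod (insort i (j # v)))
      = uscale ?e (\<iota> (basis j) * (word_prod (i # v) - uscale s (word_prod (insort i v))))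
        + \<iota> (sbracket (basis i) (basis j)) * word_prod v"
    proof -
      have "word_prod (i # j # v) = \<iota> (basis i) * \<iota> (basis j) * word_prod v"
        by (simp add: mult.assoc)
      also have "\<dots> = uscale ?e (\<iota> (basis j) * word_prod (i # v)) + \<iota> (sbracket (basis i) (basis j)) * word_prod v"
        unfolding basis_super[OF ij(1,2)] by (simp add: distrib_right mult.assoc flip: uscale_mult_left)
      finally show ?thesis using False
        by (simp add: right_diff_distrib uea.scale_right_diff_distrib flip: uscale_mult_right)
    qed
    have "\<iota> (basis j) * (word_prod (i # v) - uscale s (word_prod (insort i v))) \<in> uea.span (word_prod ` short_words I (length (j # v)))"
      using short_Cons[OF s ij(3)] by simp
    moreover have "\<iota> (sbracket (basis i) (basis j)) * word_prod v \<in> uea.span (word_prod ` short_words I (length (j # v)))"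
      by (rule short_mult) (use I assms(2) Cons.prems in \<open>auto simp: bracket_closed_def\<close>)
    ultimately show ?thesis
      using eq by (metis uea.span_add uea.span_scale)
  qed
qed

lemma word_prod_sort:
  assumes I: "bracket_closed I" and "set w \<subseteq> I"
  shows "\<exists>s. word_prod w - uscale s (word_prod (sort w)) \<in> uea.span (word_prod ` short_words I (length w - 1))"
  using assms(2)
proof (induction w)
  case Nil
  have "word_prod [] - uscale 1 (word_prod (sort [])) = 0" by simp
  then show ?case by (metis uea.span_zero)
next
  case (Cons i w)
  show ?case
  proof (cases "w = []")
    case True
    then have "word_prod (i # w) - uscale 1 (word_prod (sort (i # w))) = 0" by simp
    then show ?thesis by (metis uea.span_zero)
  next
    case False
    from Cons obtain s where s: "word_prod w - uscale s (word_prod (sort w)) \<in> uea.span (word_prod ` short_words I (length w - 1))"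
      by auto
    from word_prod_insort[OF I, of i "sort w"] Cons.prems obtain t where
      t: "word_prod (i # sort w) - uscale t (word_prod (insort i (sort w))) \<in> uea.span (word_prod ` short_words I (length w))"
      by auto
    have "\<iota> (basis i) * (word_prod w - uscale s (word_prod (sort w))) \<in> uea.span (word_prod ` short_words I (length w))"
      using short_Cons[OF s, of i] Cons.prems False by simp
    moreover have "word_prod (i # w) - uscale (s * t) (word_prod (sort (i # w)))
      = \<iota> (basis i) * (word_prod w - uscale s (word_prod (sort w)))
        + uscale s (word_prod (i # sort w) - uscale t (word_prod (insort i (sort w))))"
      by (simp add: right_diff_distrib uea.scale_right_diff_distrib flip: uscale_mult_right)
    ultimately show ?thesis using t by (metis diff_Suc_1 length_Cons uea.span_add uea.span_scale)
  qed
qed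

lemma sorted_repeated:
  assumes "sorted w" "count_list w i > 1"
  shows "\<exists>u v. w = u @ i # i # v"
proof -
  obtain u v where uv: "w = u @ i # v" "i \<notin> set u"
    using assms(2) split_list_first[of i w] by (metis count_list_0_iff not_less_zero)
  then have "i \<in> set v" using assms(2) by (metis add.right_neutral count_list.simps(2) count_list_append count_list_0_iff less_irrefl add_0)
  then obtain a v' where v: "v = a # v'" by (cases v) auto
  with \<open>i \<in> set v\<close> assms(1) uv(1) have "a = i" by (auto simp: sorted_append intro: antisym)
  then show ?thesis using uv v by blast
qed

text \<open>
  Induction on the length. Sorting changes the word by shorter ones. If the sorted word repeats an odd letter
  \<open>i\<close>, the two copies are adjacent and \<open>x\<^sub>i\<^sup>2 = [x\<^sub>i, x\<^sub>i]/2\<close> makes it shorter as well.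
\<close>
theorem straightening:
  assumes I: "bracket_closed I" and "set w \<subseteq> I" "w \<noteq> []"
  shows "word_prod w \<in> uea.span (word_prod ` (ordered_words I - {[]}))"
  using assms(2,3)
proof (induction "length w" arbitrary: w rule: less_induct)
  case less
  have short_words: "uea.span (word_prod ` short_words I (length w - 1)) \<subseteq> uea.span (word_prod ` (ordered_words I - {[]}))"
  proof (rule uea.span_minimal)
    show "word_prod ` short_words I (length w - 1) \<subseteq> uea.span (word_prod ` (ordered_words I - {[]}))"
    proof clarify
      fix v assume "v \<in> short_words I (length w - 1)"
      then show "word_prod v \<in> uea.span (word_prod ` (ordered_words I - {[]}))"
        using less.prems by (intro less.hyps) (cases w; auto simp: short_words_def)+
    qed
  qed simp
  have sorted: "word_prod (sort w) \<in> uea.span (word_prod ` (ordered_words I - {[]}))"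
  proof (cases "\<forall>i. basis_parity i = 1 \<longrightarrow> count_list (sort w) i \<le> 1")
    case True
    then have "sort w \<in> ordered_words I - {[]}" using less.prems by (auto simp: ordered_words_def simp flip: set_empty)
    then show ?thesis by (intro uea.span_base imageI)
  next
    case False
    then obtain i where i: "basis_parity i = 1" "count_list (sort w) i > 1" by auto
    then obtain u v where uv: "sort w = u @ i # i # v" using sorted_repeated[OF sorted_sort] by blast
    have set: "set (sort w) = set w" by simp
    have uvI: "set u \<subseteq> I" "i \<in> I" "set v \<subseteq> I"
      using less.prems(1) unfolding set[symmetric] uv by auto
    have len: "length w = length u + 2 + length v"
      using arg_cong[OF uv, of length] by simp
    have i9: "i < 9" using uvI I by (auto simp: bracket_closed_def)
    have "\<iota> (basis i) * \<iota> (basis i) = uscale (1/2) (\<iota> (sbracket (basis i) (basis i)))"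
    proof -
      have "\<iota> (basis i) * \<iota> (basis i) + \<iota> (basis i) * \<iota> (basis i) = \<iota> (sbracket (basis i) (basis i))"
        using basis_super[OF i9 i9] i(1) by (simp add: eq_neg_iff_add_eq_0 algebra_simps)
      moreover have "uscale (1/2) (y + y) = y" for y
        using uea.scale_left_distrib[of "1/2" "1/2" y] by (simp add: uea.scale_right_distrib)
      ultimately show ?thesis by metis
    qed
    then have "word_prod (i # i # v) = uscale (1/2) (\<iota> (sbracket (basis i) (basis i))) * word_prod v"
      by (simp flip: mult.assoc)
    also have "\<dots> \<in> uea.span (word_prod ` short_words I (Suc (length v)))"
      by (rule short_mult) (use I uvI in \<open>auto simp: bracket_closed_def intro: uea.span_scale\<close>)
    finally have v: "word_prod (i # i # v) \<in> uea.span (word_prod ` short_words I (Suc (length v)))" .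
    have "word_prod (u @ i # i # v) \<in> uea.span (word_prod ` short_words I (length u + Suc (length v)))"
      using uvI(1) by (induction u) (use v short_Cons in auto)
    then have "word_prod (sort w) \<in> uea.span (word_prod ` short_words I (length w - 1))"
      by (simp add: uv len)
    then show ?thesis using short_words by blast
  qed
  obtain s where "word_prod w - uscale s (word_prod (sort w)) \<in> uea.span (word_prod ` short_words I (length w - 1))"
    using word_prod_sort[OF I less.prems(1)] by blast
  then have "word_prod w - uscale s (word_prod (sort w)) \<in> uea.span (word_prod ` (ordered_words I - {[]}))"
    using short_words by blast
  from uea.span_add[OF this uea.span_scale[OF sorted, of s]] show ?case by simp
qed

lemma \<iota>_0: "\<iota> 0 = 0"
  using \<iota>_add[of 0 0] by simp

lemma \<iota>_sum: "\<iota> (\<Sum>j\<in>S. A j) = (\<Sum>j\<in>S. \<iota> (A j))"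
  by (induction S rule: infinite_finite_induct) (simp_all add: \<iota>_0 \<iota>_add)

lemma \<iota>_expansion: "\<iota> A = (\<Sum>j<9. uscale (coord j A) (\<iota> (basis j)))"
proof -
  have "\<iota> A = \<iota> (\<Sum>j<9. gscale (coord j A) (basis j))"
    by (rule arg_cong[OF gl12_expansion])
  also have "\<dots> = (\<Sum>j<9. uscale (coord j A) (\<iota> (basis j)))"
    by (simp only: \<iota>_sum \<iota>_scale)
  finally show ?thesis .
qed

lemma \<iota>_in_span:
  assumes "\<And>j. j < 9 \<Longrightarrow> j \<notin> I \<Longrightarrow> coord j A = 0"
  shows "\<iota> A \<in> uea.span (word_prod ` {[k] | k. k \<in> I})"
proof (subst \<iota>_expansion, rule uea.span_sum)
  fix j :: nat assume j: "j \<in> {..<9}"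
  show "uscale (coord j A) (\<iota> (basis j)) \<in> uea.span (word_prod ` {[k] | k. k \<in> I})"
  proof (cases "j \<in> I")
    case True
    then have "word_prod [j] \<in> uea.span (word_prod ` {[k] | k. k \<in> I})"
      by (intro uea.span_base imageI) blast
    then show ?thesis by (intro uea.span_scale) simp
  next
    case False
    then show ?thesis using assms[of j] j by (simp add: uea.span_zero)
  qed
qed

lemma closed_all: "bracket_closed {..<9}"
  unfolding bracket_closed_def by (intro conjI ballI \<iota>_in_span subset_refl) simp

lemma osp12_iff: "A \<in> osp12 \<longleftrightarrow> A$1$1 = 0 \<and> A$3$3 = - A$2$2 \<and> A$2$1 = - A$1$3 \<and> A$3$1 = A$1$2"
proof
  assume "A \<in> osp12"
  then show "A$1$1 = 0 \<and> A$3$3 = - A$2$2 \<and> A$2$1 = - A$1$3 \<and> A$3$1 = A$1$2"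
    by (auto simp: osp12_def)
next
  assume "A$1$1 = 0 \<and> A$3$3 = - A$2$2 \<and> A$2$1 = - A$1$3 \<and> A$3$1 = A$1$2"
  then have "A = vector [vector [0, A$1$2, A$1$3], vector [- A$1$3, A$2$2, A$2$3], vector [A$1$2, A$3$2, - A$2$2]]"
    by (simp add: vec_eq_iff forall_3)
  then show "A \<in> osp12" unfolding osp12_def by blast
qed

lemma osp12_coord: "A \<in> osp12 \<Longrightarrow> k < 9 \<Longrightarrow> k \<notin> {1..5} \<Longrightarrow> coord k A = 0"
  unfolding less_9_cases osp12_iff by (elim insertE emptyE) (simp_all add: coord_simps)

lemma basis_osp12: "i \<in> {1..5} \<Longrightarrow> basis i \<in> osp12"
proof -
  assume "i \<in> {1..5}"
  then have "i \<in> {1,2,3,4,5}" by auto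
  then show ?thesis unfolding osp12_iff
    by (elim insertE emptyE) (simp_all add: basis_simps basis_entries)
qed

lemma mult_entries: "(A ** B) $ i $ j = A$i$1 * B$1$j + A$i$2 * B$2$j + A$i$3 * (B :: gl12)$3$j"
  by (simp add: matrix_matrix_mult_def sum_3)

lemma osp12_sbracket:
  assumes osp: "A \<in> osp12" "B \<in> osp12"
    and hom: "homogeneous s A" "homogeneous t B" "s \<in> {0,1}" "t \<in> {0,1}"
  shows "sbracket A B \<in> osp12"
proof -
  consider "s = 0" "t = 0" | "s = 0" "t = Suc 0" | "s = Suc 0" "t = 0" | "s = Suc 0" "t = Suc 0"
    using hom(3,4) by auto
  then show ?thesis
    unfolding sbracket_homogeneous[OF hom] osp12_iff mult_entries entries
    using osp hom(1,2)
    by cases (simp_all add: osp12_iff homogeneous_0_iff homogeneous_1_iff algebra_simps)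
qed

lemma closed_osp: "bracket_closed {1..5}"
  unfolding bracket_closed_def
proof (intro conjI ballI)
  fix i j :: nat assume ij: "i \<in> {1..5}" "j \<in> {1..5}"
  have "sbracket (basis i) (basis j) \<in> osp12"
    by (rule osp12_sbracket[OF basis_osp12[OF ij(1)] basis_osp12[OF ij(2)] homogeneous_basis homogeneous_basis])
       (use ij in \<open>auto simp: basis_parity_def\<close>)
  then show "\<iota> (sbracket (basis i) (basis j)) \<in> uea.span (word_prod ` {[k] | k. k \<in> {1..5}})"
    by (intro \<iota>_in_span osp12_coord)
qed auto

section \<open>Relations\<close>

lemma even_commutator:
  assumes "homogeneous 0 x" "homogeneous t y" "t \<in> {0,1}"
  shows "\<iota> x * \<iota> y = \<iota> y * \<iota> x + \<iota> (x ** y - y ** x)"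
  using \<iota>_super[OF assms(1,2) _ assms(3)] sbracket_homogeneous[OF assms(1,2) _ assms(3)]
  by (simp add: gscale_one algebra_simps)

lemma odd_commutator:
  assumes "homogeneous (Suc 0) x" "homogeneous (Suc 0) y"
  shows "\<iota> x * \<iota> y = - (\<iota> y * \<iota> x) + \<iota> (x ** y + y ** x)"
proof -
  have "gscale (-1) A = - A" for A by (simp add: gscale_def vec_eq_iff)
  then show ?thesis
  using \<iota>_super[OF assms] sbracket_homogeneous[OF assms]
  by (simp add: algebra_simps)
qed

lemma even_basis: "homogeneous 0 g_z" "homogeneous 0 g_k" "homogeneous 0 g_k1" "homogeneous 0 g_k2" "homogeneous 0 g_p"
  by (simp_all add: homogeneous_0_iff basis_entries)

lemma odd_basis: "homogeneous (Suc 0) g_e'" "homogeneous (Suc 0) g_f'" "homogeneous (Suc 0) g_e" "homogeneous (Suc 0) g_f"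
  by (simp_all add: homogeneous_1_iff basis_entries)

lemma \<iota>_uminus: "\<iota> (- x) = - \<iota> x"
  using \<iota>_add[of x "- x"] by (simp add: \<iota>_0 eq_neg_iff_add_eq_0 add.commute)

lemmas matrix_simps = vec_eq_iff forall_3 mult_entries entries basis_entries

lemma z_central_gen: "\<iota> g_z * \<iota> x = \<iota> x * \<iota> g_z"
proof -
  have "component 0 x + component 1 x = x"
    by (simp add: component_def vec_eq_iff)
  moreover have "\<iota> g_z * \<iota> (component t x) = \<iota> (component t x) * \<iota> g_z" if t: "t \<in> {0,1}" for t
  proof -
    have "homogeneous t (component t x)" by (simp add: homogeneous_def component_def vec_eq_iff)
    from even_commutator[OF even_basis(1) this t]
    have "\<iota> g_z * \<iota> (component t x) = \<iota> (component t x) * \<iota> g_z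
      + \<iota> (g_z ** component t x - component t x ** g_z)" .
    moreover have "g_z ** component t x - component t x ** g_z = 0" by (simp add: matrix_simps)
    ultimately show ?thesis by (simp add: \<iota>_0)
  qed
  moreover have "\<iota> g_z * \<iota> (component 0 x + component 1 x) = \<iota> (component 0 x + component 1 x) * \<iota> g_z"
    by (simp add: \<iota>_add distrib_left distrib_right calculation(2))
  ultimately show ?thesis by simp
qed

lemma p_k: "\<iota> g_p * \<iota> g_k = \<iota> g_k * \<iota> g_p"
  and p_k1: "\<iota> g_p * \<iota> g_k1 = \<iota> g_k1 * \<iota> g_p"
  and p_k2: "\<iota> g_p * \<iota> g_k2 = \<iota> g_k2 * \<iota> g_p"
proof -
  have "g_p ** g_k - g_k ** g_p = 0" "g_p ** g_k1 - g_k1 ** g_p = 0" "g_p ** g_k2 - g_k2 ** g_p = 0"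
    by (simp_all add: matrix_simps)
  then show "\<iota> g_p * \<iota> g_k = \<iota> g_k * \<iota> g_p" "\<iota> g_p * \<iota> g_k1 = \<iota> g_k1 * \<iota> g_p"
    "\<iota> g_p * \<iota> g_k2 = \<iota> g_k2 * \<iota> g_p"
    using even_commutator[OF even_basis(5) even_basis(2)] even_commutator[OF even_basis(5) even_basis(3)]
      even_commutator[OF even_basis(5) even_basis(4)] by (simp_all add: \<iota>_0)
qed

lemma p_odd:
  "\<iota> g_p * \<iota> g_e' = \<iota> g_e' * \<iota> g_p + \<iota> g_e"
  "\<iota> g_p * \<iota> g_f' = \<iota> g_f' * \<iota> g_p + \<iota> g_f"
  "\<iota> g_p * \<iota> g_e = \<iota> g_e * \<iota> g_p + \<iota> g_e'"
  "\<iota> g_p * \<iota> g_f = \<iota> g_f * \<iota> g_p + \<iota> g_f'"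
proof -
  have "g_p ** g_e' - g_e' ** g_p = g_e" "g_p ** g_f' - g_f' ** g_p = g_f"
    "g_p ** g_e - g_e ** g_p = g_e'" "g_p ** g_f - g_f ** g_p = g_f'"
    by (simp_all add: matrix_simps)
  then show
  "\<iota> g_p * \<iota> g_e' = \<iota> g_e' * \<iota> g_p + \<iota> g_e"
  "\<iota> g_p * \<iota> g_f' = \<iota> g_f' * \<iota> g_p + \<iota> g_f"
  "\<iota> g_p * \<iota> g_e = \<iota> g_e * \<iota> g_p + \<iota> g_e'"
  "\<iota> g_p * \<iota> g_f = \<iota> g_f * \<iota> g_p + \<iota> g_f'"
    using even_commutator[OF even_basis(5) odd_basis(1)] even_commutator[OF even_basis(5) odd_basis(2)]
      even_commutator[OF even_basis(5) odd_basis(3)] even_commutator[OF even_basis(5) odd_basis(4)] by simp_all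
qed

lemma uscale_half: "uscale (1/2) (u + u) = u"
  using uea.scale_left_distrib[of "1/2" "1/2" u] by (simp add: uea.scale_right_distrib)

lemma half_sq: "x * x = - (x * x) + (y + y) \<Longrightarrow> x * x = (y :: uea)"
proof -
  assume "x * x = - (x * x) + (y + y)"
  then have "(x * x) + (x * x) = y + y" by (metis add.assoc add.left_neutral add.right_inverse)
  then show ?thesis by (metis uscale_half)
qed

lemma odd_square: "homogeneous (Suc 0) x \<Longrightarrow> \<iota> x * \<iota> x = \<iota> (x ** x)"
  by (rule half_sq) (use odd_commutator[of x x] in \<open>simp only: \<iota>_add\<close>)

lemma odd_squares:
  "\<iota> g_e' * \<iota> g_e' = \<iota> g_k2"
  "\<iota> g_f' * \<iota> g_f' = - \<iota> g_k1"
  "\<iota> g_e * \<iota> g_e = - \<iota> g_k2"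
  "\<iota> g_f * \<iota> g_f = \<iota> g_k1"
proof -
  have "g_e' ** g_e' = g_k2" "g_f' ** g_f' = - g_k1" "g_e ** g_e = - g_k2" "g_f ** g_f = g_k1"
    by (simp_all add: matrix_simps)
  then show
  "\<iota> g_e' * \<iota> g_e' = \<iota> g_k2"
  "\<iota> g_f' * \<iota> g_f' = - \<iota> g_k1"
  "\<iota> g_e * \<iota> g_e = - \<iota> g_k2"
  "\<iota> g_f * \<iota> g_f = \<iota> g_k1"
    by (simp_all add: odd_square odd_basis \<iota>_uminus)
qed

lemma odd_relations:
  "\<iota> g_e' * \<iota> g_f' = - (\<iota> g_f' * \<iota> g_e') - \<iota> g_k"
  "\<iota> g_e * \<iota> g_e' = - (\<iota> g_e' * \<iota> g_e)"
  "\<iota> g_f * \<iota> g_f' = - (\<iota> g_f' * \<iota> g_f)"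
  "\<iota> g_e * \<iota> g_f' = - (\<iota> g_f' * \<iota> g_e) - \<iota> g_p"
  "\<iota> g_f * \<iota> g_e' = - (\<iota> g_e' * \<iota> g_f) + \<iota> g_p"
  "\<iota> g_f * \<iota> g_e = - (\<iota> g_e * \<iota> g_f) + \<iota> g_k"
proof -
  have m: "g_e' ** g_f' + g_f' ** g_e' = - g_k" "g_e ** g_e' + g_e' ** g_e = 0"
   "g_f ** g_f' + g_f' ** g_f = 0" "g_e ** g_f' + g_f' ** g_e = - g_p"
   "g_f ** g_e' + g_e' ** g_f = g_p" "g_f ** g_e + g_e ** g_f = g_k"
    by (simp_all add: matrix_simps)
  show
  "\<iota> g_e' * \<iota> g_f' = - (\<iota> g_f' * \<iota> g_e') - \<iota> g_k"
  "\<iota> g_e * \<iota> g_e' = - (\<iota> g_e' * \<iota> g_e)"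
  "\<iota> g_f * \<iota> g_f' = - (\<iota> g_f' * \<iota> g_f)"
  "\<iota> g_e * \<iota> g_f' = - (\<iota> g_f' * \<iota> g_e) - \<iota> g_p"
  "\<iota> g_f * \<iota> g_e' = - (\<iota> g_e' * \<iota> g_f) + \<iota> g_p"
  "\<iota> g_f * \<iota> g_e = - (\<iota> g_e * \<iota> g_f) + \<iota> g_k"
    using odd_commutator[OF odd_basis(1,2)] odd_commutator[OF odd_basis(3,1)]
      odd_commutator[OF odd_basis(4,2)] odd_commutator[OF odd_basis(3,2)]
      odd_commutator[OF odd_basis(4,1)] odd_commutator[OF odd_basis(4,3)]
    unfolding m by (simp_all add: \<iota>_0 \<iota>_uminus)
qed

lemma e_k1: "\<iota> g_e * \<iota> g_k1 = \<iota> g_k1 * \<iota> g_e + \<iota> g_f"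
proof -
  have "g_k1 ** g_e - g_e ** g_k1 = - g_f" by (simp add: matrix_simps)
  then show ?thesis using even_commutator[OF even_basis(3) odd_basis(3)]
    by (simp only: \<iota>_uminus) simp
qed

section \<open>The PBW basis\<close>

lemma prod_\<iota>_in_span: "prod_list (map \<iota> w) \<in> uea.span (word_prod ` {w. set w \<subseteq> {..<9}})"
proof (induction w)
  case Nil
  have "word_prod [] \<in> uea.span (word_prod ` {w. set w \<subseteq> {..<9}})"
    by (intro uea.span_base imageI) simp
  then show ?case by simp
next
  case (Cons x w)
  have "\<iota> x * prod_list (map \<iota> w) = (\<Sum>j<9. uscale (coord j x) (\<iota> (basis j) * prod_list (map \<iota> w)))"
    by (subst \<iota>_expansion) (simp add: sum_distrib_right flip: uscale_mult_left)
  also have "\<dots> \<in> uea.span (word_prod ` {w. set w \<subseteq> {..<9}})"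
  proof (intro uea.span_sum uea.span_scale)
    fix j :: nat assume j: "j \<in> {..<9}"
    show "\<iota> (basis j) * prod_list (map \<iota> w) \<in> uea.span (word_prod ` {w. set w \<subseteq> {..<9}})"
      by (rule span_mult_left[OF _ Cons.IH])
         (use j in \<open>auto intro!: uea.span_base rev_image_eqI[of "j # _"]\<close>)
  qed
  finally show ?case by simp
qed

lemma word_prod_spans: "u \<in> uea.span (word_prod ` {w. set w \<subseteq> {..<9}})"
proof -
  obtain f where f: "u = abs_uea f"
    using Quotient_abs_rep[OF Quotient_uea] by metis
  have "abs_uea f \<in> uea.span (word_prod ` {w. set w \<subseteq> {..<9}})"
  proof (induction f rule: poly_mapping_induct)
    case (single w c)
    have "abs_uea (Poly_Mapping.single w 1) = prod_list (map \<iota> w)"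
    proof (induction w)
      case Nil
      then show ?case by (simp add: one_uea.abs_eq const_1[unfolded const_def])
    next
      case (Cons x w)
      have "Poly_Mapping.single (x # w) 1 = gen x * Poly_Mapping.single w 1"
        by (simp add: gen_def mult_single plus_list_def)
      then show ?case using Cons.IH by (simp add: times_uea.abs_eq[symmetric] \<iota>.abs_eq)
    qed
    moreover have "Poly_Mapping.single w c = const c * Poly_Mapping.single w 1"
      by (simp add: const_def mult_single plus_list_def)
    ultimately have "abs_uea (Poly_Mapping.single w c) = uscale c (prod_list (map \<iota> w))"
      by (simp add: uscale.abs_eq[symmetric])
    then show ?case by (simp add: uea.span_scale prod_\<iota>_in_span)
  next
    case (add f g)
    then show ?case by (simp add: plus_uea.abs_eq[symmetric] uea.span_add)
  qed
  then show ?thesis by (simp add: f)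
qed

lemma ordered_words_span: "u \<in> uea.span (word_prod ` ordered_words {..<9})"
proof -
  have "uea.span (word_prod ` {w. set w \<subseteq> {..<9}}) \<subseteq> uea.span (word_prod ` ordered_words {..<9})"
  proof (rule uea.span_minimal)
    show "word_prod ` {w. set w \<subseteq> {..<9}} \<subseteq> uea.span (word_prod ` ordered_words {..<9})"
    proof clarify
      fix w assume w: "set w \<subseteq> {..<(9::nat)}"
      show "word_prod w \<in> uea.span (word_prod ` ordered_words {..<9})"
      proof (cases "w = []")
        case True
        then show ?thesis by (intro uea.span_base imageI) (simp add: ordered_words_def)
      next
        case False
        from straightening[OF closed_all w False] show ?thesis
          using uea.span_mono[of "word_prod ` (ordered_words {..<9} - {[]})" "word_prod ` ordered_words {..<9}"] by blast
      qed
    qed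
  qed simp
  then show ?thesis using word_prod_spans by blast
qed

definition pbw_coord :: "nat list \<Rightarrow> uea \<Rightarrow> complex" where
  "pbw_coord w u = uea.representation (word_prod ` ordered_words {..<9}) u (word_prod w)"

lemma pbw_coord_add: "pbw_coord w (u + v) = pbw_coord w u + pbw_coord w v"
  unfolding pbw_coord_def using pbw_independent ordered_words_span by (simp add: uea.representation_add)

lemma pbw_coord_diff: "pbw_coord w (u - v) = pbw_coord w u - pbw_coord w v"
  unfolding pbw_coord_def using pbw_independent ordered_words_span by (simp add: uea.representation_diff)

lemma pbw_coord_scale: "pbw_coord w (uscale c u) = c * pbw_coord w u"
  unfolding pbw_coord_def using pbw_independent ordered_words_span by (simp add: uea.representation_scale)

lemma pbw_coord_sum: "pbw_coord w (\<Sum>i\<in>S. u i) = (\<Sum>i\<in>S. pbw_coord w (u i))"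
  unfolding pbw_coord_def using pbw_independent ordered_words_span by (simp add: uea.representation_sum)

lemma pbw_coord_word_prod:
  assumes "v \<in> ordered_words {..<9}" "w \<in> ordered_words {..<9}"
  shows "pbw_coord w (word_prod v) = (if v = w then 1 else 0)"
  unfolding pbw_coord_def using assms pbw_independent
  by (subst uea.representation_basis) (auto dest: inj_onD)

section \<open>The polynomials alpha and beta\<close>

lemma peval_superset: "degree q \<le> n \<Longrightarrow> peval q x = (\<Sum>i\<le>n. uscale (coeff q i) (x ^ i))"
  unfolding peval_def
  by (rule sum.mono_neutral_left) (auto simp: coeff_eq_0)

lemma peval_0 [simp]: "peval 0 x = 0"
  by (simp add: peval_def)

lemma peval_pCons: "peval (pCons a q) x = uscale a 1 + x * peval q x"
proof -
  have "peval (pCons a q) x = (\<Sum>i\<le>Suc (degree q). uscale (coeff (pCons a q) i) (x ^ i))"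
    by (rule peval_superset) (simp add: degree_pCons_le)
  also have "\<dots> = uscale a 1 + x * peval q x"
    unfolding sum.atMost_Suc_shift by (simp add: peval_def sum_distrib_left flip: uscale_mult_right)
  finally show ?thesis .
qed

lemma peval_add: "peval (q + r) x = peval q x + peval r x"
proof -
  let ?n = "max (degree q) (degree r)"
  have "degree (q + r) \<le> ?n" by (rule degree_add_le) auto
  then show ?thesis
    by (simp add: peval_superset[of _ ?n] uea.scale_left_distrib sum.distrib)
qed

lemma peval_smult: "peval (smult c q) x = uscale c (peval q x)"
  by (subst peval_superset[of _ "degree q"]) (simp_all add: degree_smult_le peval_def uea.scale_sum_right)

lemma peval_uminus: "peval (- q) x = - peval q x"
  using peval_add[of q "- q" x] by (simp add: eq_neg_iff_add_eq_0 add.commute)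

lemma peval_diff: "peval (q - r) x = peval q x - peval r x"
  using peval_add[of q "- r" x] by (simp add: peval_uminus)

lemma peval_monom: "peval (monom c n) x = uscale c (x ^ n)"
  by (induction n) (simp_all add: monom_0 monom_Suc peval_pCons uscale_mult_right)

lemma peval_commute: "x * y = y * x \<Longrightarrow> peval q x * y = y * peval q x"
proof (induction q)
  case (pCons a q)
  have "x * peval q x * y = y * (x * peval q x)"
    using pCons by (metis mult.assoc)
  then show ?case
    by (simp add: peval_pCons distrib_left distrib_right flip: uscale_mult_left uscale_mult_right)
qed simp

text \<open>
  The hypothesis says \<open>x y = y (x + c)\<close>, so each factor \<open>x\<close> of a monomial becomes \<open>x + c\<close> when it passes \<open>y\<close>.
\<close>
lemma peval_shift:
  assumes "x * y = y * x + uscale c y"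
  shows "peval q x * y = y * peval (pcompose q [:c, 1:]) x"
proof (induction q)
  case (pCons a q)
  let ?r = "peval (pcompose q [:c, 1:]) x"
  have "peval (pcompose (pCons a q) [:c, 1:]) x = uscale a 1 + (uscale c ?r + x * ?r)"
    by (simp add: pcompose_pCons peval_add peval_pCons peval_smult)
  moreover have "x * (peval q x * y) = y * x * ?r + uscale c (y * ?r)"
    unfolding pCons.IH by (simp add: assms distrib_right uscale_mult_left flip: mult.assoc)
  ultimately show ?case
    by (simp add: peval_pCons distrib_left distrib_right mult.assoc flip: uscale_mult_left uscale_mult_right)
qed simp

text \<open>
  Averaging the two shifts preserves the leading term, so \<open>q\<close> itself is a first approximation to the
  solution and the error has smaller degree.
\<close>
lemma average_shift_surj:
  "\<exists>r :: complex poly. pcompose r [:1, 1:] + pcompose r [:-1, 1:] = smult 2 q \<and> degree r \<le> degree q"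
proof (induction "degree q" arbitrary: q rule: less_induct)
  case less
  show ?case
  proof (cases "degree q = 0")
    case True
    then obtain c where "q = [:c:]" by (metis degree_eq_zeroE)
    then show ?thesis by (intro exI[of _ q]) (simp add: pcompose_pCons)
  next
    case False
    define q' where "q' = smult (1/2) (smult 2 q - (pcompose q [:1, 1:] + pcompose q [:-1, 1:]))"
    \<comment> \<open>A shift does not change the leading coefficient, so \<open>q\'\<close> loses the term of top degree.\<close>
    have lead: "coeff (pcompose q [:c, 1:]) (degree q) = lead_coeff q" for c :: complex
      using lead_coeff_comp[of "[:c, 1:]" q] degree_pcompose[of q "[:c, 1:]"] by simp
    have "degree q' \<le> degree q"
      unfolding q'_def
      by (intro order_trans[OF degree_smult_le] degree_diff_le degree_add_le) (simp_all add: degree_pcompose)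
    moreover have "coeff q' (degree q) = 0"
      unfolding q'_def by (simp add: lead)
    ultimately have "degree q' < degree q"
      using False by (metis degree_0 le_neq_implies_less leading_coeff_0_iff not_gr_zero)
    from less[OF this] obtain r where r: "pcompose r [:1, 1:] + pcompose r [:-1, 1:] = smult 2 q'" "degree r \<le> degree q'"
      by blast
    have "pcompose (q + r) [:1, 1:] + pcompose (q + r) [:-1, 1:]
       = (pcompose q [:1, 1:] + pcompose q [:-1, 1:]) + smult 2 q'"
      unfolding r(1)[symmetric] by (simp add: pcompose_add)
    also have "\<dots> = smult 2 q" by (simp add: q'_def)
    finally have "pcompose (q + r) [:1, 1:] + pcompose (q + r) [:-1, 1:] = smult 2 q" .
    moreover have "degree (q + r) \<le> degree q"
      using r(2) \<open>degree q' < degree q\<close> by (intro degree_add_le) auto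
    ultimately show ?thesis by blast
  qed
qed

text \<open>
  The property by which \<open>alpha_beta n\<close> is chosen.
\<close>
definition p_power_relation :: "nat \<Rightarrow> complex poly \<Rightarrow> complex poly \<Rightarrow> bool" where
  "p_power_relation n \<alpha> \<beta> \<longleftrightarrow> (\<forall>a b. \<iota> g_p ^ n * \<iota> (v_k a b)
      = \<iota> (v_k a b) * peval \<alpha> (\<iota> g_p) + peval \<beta> (\<iota> g_p) * \<iota> (v_p a b))"

lemma \<iota>_v: "\<iota> (v_k a b) = uscale a (\<iota> g_e') + uscale b (\<iota> g_f')"
  "\<iota> (v_p a b) = uscale a (\<iota> g_e) + uscale b (\<iota> g_f)"
  by (simp_all add: v_k_def v_p_def \<iota>_add \<iota>_scale)

lemma p_v:
  "\<iota> g_p * \<iota> (v_k a b) = \<iota> (v_k a b) * \<iota> g_p + \<iota> (v_p a b)"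
  "\<iota> g_p * \<iota> (v_p a b) = \<iota> (v_p a b) * \<iota> g_p + \<iota> (v_k a b)"
  by (simp_all add: \<iota>_v distrib_left distrib_right p_odd uea.scale_right_distrib
      flip: uscale_mult_left uscale_mult_right)

lemma pcompose_shift: "pcompose (pcompose r [:a, 1:]) [:b, 1:] = pcompose r [:a + b, 1 :: complex:]"
  by (simp add: pcompose_assoc[symmetric] pcompose_pCons)

text \<open>
  In terms of the eigenvectors \<open>w = v\<^sub>\<kk> + v\<^sub>\<pp>\<close> and \<open>u = v\<^sub>\<kk> - v\<^sub>\<pp>\<close> of \<open>[p, \<cdot>]\<close>, the relation amounts to
  \<open>\<alpha>(x) + \<beta>(x + 1) = (x + 1)\<^sup>n\<close> and \<open>\<alpha>(x) - \<beta>(x - 1) = (x - 1)\<^sup>n\<close>. These hold if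
  \<open>\<alpha>(x + 1) + \<alpha>(x - 1) = 2x\<^sup>n\<close> and \<open>\<beta>(x) = (\<alpha>(x + 1) - \<alpha>(x - 1))/2\<close>.
\<close>
lemma p_power_relation_exists: "\<exists>\<alpha> \<beta>. p_power_relation n \<alpha> \<beta> \<and> degree \<beta> \<le> n"
proof -
  obtain r :: "complex poly" where r: "pcompose r [:1, 1:] + pcompose r [:-1, 1:] = smult 2 (monom 1 n)" "degree r \<le> n"
    using average_shift_surj[of "monom 1 n"] by (auto simp: degree_monom_eq)
  define \<beta> where "\<beta> = smult (1/2) (pcompose r [:1, 1:] - pcompose r [:-1, 1:])"
  let ?P = "\<iota> g_p"
  have q2: "pcompose (smult 2 (monom 1 n)) [:c, 1:] = pcompose r [:1 + c, 1:] + pcompose r [:-1 + c, 1 :: complex:]" for c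
    unfolding r(1)[symmetric] by (simp add: pcompose_add pcompose_shift)
  have id: "pcompose r [:0, 1:] = r" by (simp add: pcompose_idR)
  have half: "smult 2 x = y + y' \<Longrightarrow> x = smult (1/2) (y + y')" for x y y' :: "complex poly"
    by (metis mult.commute nonzero_mult_div_cancel_left divide_inverse inverse_eq_divide smult_1_left smult_smult zero_neq_numeral)
  have m1: "pcompose (monom 1 n) [:1, 1:] = r + pcompose \<beta> [:1, 1:]"
  proof -
    have "pcompose (monom 1 n) [:1, 1:] = smult (1/2) (pcompose r [:2, 1:] + r)"
      by (rule half) (use q2[of 1] id in \<open>simp add: pcompose_smult\<close>)
    also have "\<dots> = r + smult (1/2) (pcompose r [:2, 1:] - r)"
      using smult_add_left[of "1/2" "1/2" r] by (simp add: smult_add_right smult_diff_right)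
    finally show ?thesis
      by (simp add: \<beta>_def pcompose_smult pcompose_diff pcompose_shift id)
  qed
  have m2: "pcompose (monom 1 n) [:-1, 1:] = r - pcompose \<beta> [:-1, 1:]"
  proof -
    have "pcompose (monom 1 n) [:-1, 1:] = smult (1/2) (r + pcompose r [:-2, 1:])"
      by (rule half) (use q2[of "-1"] id in \<open>simp add: pcompose_smult\<close>)
    also have "\<dots> = r - smult (1/2) (r - pcompose r [:-2, 1:])"
      using smult_add_left[of "1/2" "1/2" r] by (simp add: smult_add_right smult_diff_right algebra_simps)
    finally show ?thesis
      by (simp add: \<beta>_def pcompose_smult pcompose_diff pcompose_shift id)
  qed
  have "p_power_relation n r \<beta>" unfolding p_power_relation_def
  proof (intro allI)
    fix a b
    define vk vp where "vk = \<iota> (v_k a b)" "vp = \<iota> (v_p a b)"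
    define w u where "w = vk + vp" "u = vk - vp"
    have w: "?P * w = w * ?P + uscale 1 w" and u: "?P * u = u * ?P + uscale (-1) u"
      by (simp_all add: w_u_def vk_vp_def distrib_left distrib_right right_diff_distrib left_diff_distrib p_v)
    have pn: "?P ^ n = peval (monom 1 n) ?P" by (simp add: peval_monom)
    have sum: "vk + vk = w + u" and diff: "vp + vp = w - u" by (simp_all add: w_u_def)
    have "?P ^ n * (vk + vk) = w * peval (pcompose (monom 1 n) [:1, 1:]) ?P + u * peval (pcompose (monom 1 n) [:-1, 1:]) ?P"
      unfolding sum pn by (simp add: distrib_left peval_shift[OF w] peval_shift[OF u])
    also have "\<dots> = (w + u) * peval r ?P + (peval \<beta> ?P * w - peval \<beta> ?P * u)"
      unfolding m1 m2 peval_shift[OF w] peval_shift[OF u]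
      by (simp add: peval_add peval_diff algebra_simps)
    also have "\<dots> = (vk + vk) * peval r ?P + peval \<beta> ?P * (vp + vp)"
      unfolding sum diff by (simp add: right_diff_distrib)
    finally have "?P ^ n * vk + ?P ^ n * vk = (vk * peval r ?P + peval \<beta> ?P * vp) + (vk * peval r ?P + peval \<beta> ?P * vp)"
      by (simp add: algebra_simps)
    then show "?P ^ n * vk = vk * peval r ?P + peval \<beta> ?P * vp" by (metis uscale_half)
  qed
  moreover have "degree \<beta> \<le> n"
    unfolding \<beta>_def by (intro order_trans[OF degree_smult_le] degree_diff_le) (simp_all add: degree_pcompose r)
  ultimately show ?thesis by blast
qed

lemma count_list_replicate: "count_list (replicate n x) y = (if x = y then n else 0)"
  by (induction n) auto

lemma word_prod_replicate: "word_prod (replicate n i) = \<iota> (basis i) ^ n"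
  by (induction n) simp_all

text \<open>
  The monomials \<open>e'p\<^sup>i\<close> and \<open>p\<^sup>je\<close> are distinct members of the PBW basis.
\<close>
lemma peval_unique:
  assumes "\<iota> g_e' * peval q (\<iota> g_p) + peval r (\<iota> g_p) * \<iota> g_e = 0"
  shows "q = 0 \<and> r = 0"
proof -
  let ?w1 = "\<lambda>i. 4 # replicate i 6" and ?w2 = "\<lambda>i. replicate i 6 @ [7]"
  have red: "?w1 i \<in> ordered_words {..<9}" "?w2 i \<in> ordered_words {..<9}" for i
    by (auto simp: ordered_words_def sorted_append count_list_replicate basis_parity_def)
  have e1: "\<iota> g_e' * peval q (\<iota> g_p) = (\<Sum>i\<le>degree q. uscale (coeff q i) (word_prod (?w1 i)))"
    by (simp add: peval_def sum_distrib_left word_prod_replicate basis_simps flip: uscale_mult_right)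
  have e2: "peval r (\<iota> g_p) * \<iota> g_e = (\<Sum>i\<le>degree r. uscale (coeff r i) (word_prod (?w2 i)))"
    by (simp add: peval_def sum_distrib_right word_prod_append word_prod_replicate basis_simps flip: uscale_mult_left)
  have ne1: "(?w1 i :: nat list) \<noteq> ?w2 j" for i j
    by (rule notI, drule arg_cong[where f = "\<lambda>w. (7::nat) \<in> set w"]) simp
  note ne = ne1 ne1[symmetric]
  have p0: "pbw_coord w 0 = 0" for w using pbw_coord_diff[of w 0 0] by simp
  have "coeff q i = 0" for i
  proof -
    have "pbw_coord (?w1 i) (\<iota> g_e' * peval q (\<iota> g_p) + peval r (\<iota> g_p) * \<iota> g_e) = (if i \<le> degree q then coeff q i else 0)"
      unfolding e1 e2 by (simp add: pbw_coord_add pbw_coord_sum pbw_coord_scale pbw_coord_word_prod red ne sum.delta if_distrib del: word_prod_simps cong: if_cong)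
    then show ?thesis unfolding assms p0 by (auto split: if_splits intro: coeff_eq_0)
  qed
  moreover have "coeff r i = 0" for i
  proof -
    have "pbw_coord (?w2 i) (\<iota> g_e' * peval q (\<iota> g_p) + peval r (\<iota> g_p) * \<iota> g_e) = (if i \<le> degree r then coeff r i else 0)"
      unfolding e1 e2 by (simp add: pbw_coord_add pbw_coord_sum pbw_coord_scale pbw_coord_word_prod red ne sum.delta if_distrib del: word_prod_simps cong: if_cong)
    then show ?thesis unfolding assms p0 by (auto split: if_splits intro: coeff_eq_0)
  qed
  ultimately show ?thesis by (simp add: poly_eq_iff)
qed

lemma p_power_relation_unique:
  assumes "p_power_relation n \<alpha> \<beta>" "p_power_relation n \<alpha>' \<beta>'"
  shows "\<alpha> = \<alpha>' \<and> \<beta> = \<beta>'"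
proof -
  have v: "\<iota> (v_k 1 0) = \<iota> g_e'" "\<iota> (v_p 1 0) = \<iota> g_e" by (simp_all add: \<iota>_v)
  have "\<iota> g_e' * peval (\<alpha> - \<alpha>') (\<iota> g_p) + peval (\<beta> - \<beta>') (\<iota> g_p) * \<iota> g_e = 0"
    using assms[unfolded p_power_relation_def, rule_format, of 1 0]
    by (simp add: v peval_diff algebra_simps)
  from peval_unique[OF this] show ?thesis by simp
qed

text \<open>
  For \<open>n = 0\<close> the convention \<open>\<beta>\<^sub>-\<^sub>1 = 0\<close> agrees with the relation, which then reads \<open>v\<^sub>\<kk> = v\<^sub>\<kk>\<close>. The crude
  bound on the degree suffices for the recursion in \<open>I_e\<close> and \<open>I_f\<close>.
\<close>
lemma beta_pred_relation: "\<exists>\<alpha>. p_power_relation n \<alpha> (beta_pred n)" and degree_beta_pred: "degree (beta_pred n) \<le> n"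
proof -
  obtain \<alpha> \<beta> where ab: "p_power_relation n \<alpha> \<beta>" "degree \<beta> \<le> n" using p_power_relation_exists by blast
  have "alpha_beta n = (\<alpha>, \<beta>)"
    unfolding alpha_beta_def
  proof (rule the_equality)
    show "case (\<alpha>, \<beta>) of (\<alpha>, \<beta>) \<Rightarrow> \<forall>a b. \<iota> g_p ^ n * \<iota> (v_k a b) =
      \<iota> (v_k a b) * peval \<alpha> (\<iota> g_p) + peval \<beta> (\<iota> g_p) * \<iota> (v_p a b)"
      using ab(1) by (simp add: p_power_relation_def)
  next
    fix x :: "complex poly \<times> complex poly"
    assume "case x of (\<alpha>, \<beta>) \<Rightarrow> \<forall>a b. \<iota> g_p ^ n * \<iota> (v_k a b) =
      \<iota> (v_k a b) * peval \<alpha> (\<iota> g_p) + peval \<beta> (\<iota> g_p) * \<iota> (v_p a b)"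
    then have "p_power_relation n (fst x) (snd x)" by (simp add: p_power_relation_def case_prod_unfold)
    from p_power_relation_unique[OF this ab(1)] show "x = (\<alpha>, \<beta>)" by (cases x) auto
  qed
  moreover have "\<beta> = 0" if "n = 0"
  proof -
    have "p_power_relation 0 1 0" by (simp add: p_power_relation_def peval_def)
    with p_power_relation_unique ab(1) that show ?thesis by blast
  qed
  ultimately have "beta_pred n = \<beta>" by (simp add: beta_pred_def)
  with ab show "\<exists>\<alpha>. p_power_relation n \<alpha> (beta_pred n)" "degree (beta_pred n) \<le> n" by auto
qed

section \<open>The right ideal generated by osp(1|2)\<close>

lemma z_central: "\<iota> g_z * u = u * \<iota> g_z"
proof -
  have w: "\<iota> g_z * word_prod w = word_prod w * \<iota> g_z" for w
    by (induction w) (simp_all add: z_central_gen flip: mult.assoc, simp add: mult.assoc z_central_gen)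
  show ?thesis
    using ordered_words_span[of u]
  proof (induction rule: uea.span_induct_alt)
    case (step c x y)
    then show ?case
      by (auto simp: distrib_left distrib_right w simp flip: uscale_mult_left uscale_mult_right)
  qed simp
qed

lemma z_power_central: "\<iota> g_z ^ m * u = u * \<iota> g_z ^ m"
  by (rule power_commuting_commutes[OF z_central, symmetric, THEN sym])

lemma word_prod_z_central: "set w \<subseteq> {0} \<Longrightarrow> word_prod w * u = u * word_prod w"
proof (induction w arbitrary: u)
  case (Cons i w)
  then have "i = 0" and "word_prod w * u = u * word_prod w" by auto
  have "word_prod (i # w) * u = \<iota> g_z * (u * word_prod w)"
    using \<open>i = 0\<close> \<open>word_prod w * u = u * word_prod w\<close> by (simp add: basis_simps mult.assoc)
  also have "\<dots> = u * word_prod (i # w)"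
    using \<open>i = 0\<close> z_central[of u] by (simp add: basis_simps flip: mult.assoc)
  finally show ?case .
qed simp

lemma sorted_split:
  assumes "sorted w"
  shows "w = filter (\<lambda>i. i = 0) w @ filter (\<lambda>i. i \<in> {1..5}) w @ filter (\<lambda>i. 5 < i) (w :: nat list)"
proof (rule sorted_mset_eqI[OF assms])
  show "sorted (filter (\<lambda>i. i = 0) w @ filter (\<lambda>i. i \<in> {1..5}) w @ filter (\<lambda>i. 5 < i) w)"
    using assms by (auto simp: sorted_append sorted_filter[of id, simplified])
  show "mset w = mset (filter (\<lambda>i. i = 0) w @ filter (\<lambda>i. i \<in> {1..5}) w @ filter (\<lambda>i. 5 < i) w)"
    by (induction w) auto
qed

text \<open>
  The order of the basis puts \<open>z\<close> first, then osp(1|2), then \<open>p, e, f\<close>.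
\<close>
lemma ordered_words_split:
  assumes "w \<in> ordered_words {..<9}"
  obtains a v t where "w = a @ v @ t" "set a \<subseteq> {0}" "v \<in> ordered_words {1..5}" "t \<in> ordered_words {6..8}"
proof
  show "w = filter (\<lambda>i. i = 0) w @ filter (\<lambda>i. i \<in> {1..5}) w @ filter (\<lambda>i. 5 < i) w"
    using assms by (intro sorted_split) (simp add: ordered_words_def)
  have c: "count_list (filter P w) i \<le> count_list w i" for P i
    by (induction w) auto
  have "\<forall>i. basis_parity i = 1 \<longrightarrow> count_list (filter P w) i \<le> 1" for P
    using assms c[of P] order_trans unfolding ordered_words_def by blast
  then show "filter (\<lambda>i. i \<in> {1..5}) w \<in> ordered_words {1..5}" "filter (\<lambda>i. 5 < i) w \<in> ordered_words {6..8}"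
    using assms by (auto simp: ordered_words_def sorted_filter[of id, simplified])
qed auto

lemma ordered_words_join:
  assumes "set a \<subseteq> {0}" "v \<in> ordered_words {1..5}" "t \<in> ordered_words {6..8}"
  shows "a @ v @ t \<in> ordered_words {..<9}"
proof -
  have a: "sorted a" using assms(1) by (induction a) auto
  have "count_list (a @ v @ t) i \<le> 1" if i: "basis_parity i = 1" for i
  proof -
    have "i \<notin> set a" using assms(1) i by (auto simp: basis_parity_def)
    moreover have "i \<notin> set v \<or> i \<notin> set t" using assms(2,3) by (fastforce simp: ordered_words_def)
    moreover have "count_list v i \<le> 1" "count_list t i \<le> 1"
      using assms(2,3) i by (auto simp: ordered_words_def)
    ultimately show ?thesis by (auto simp: count_list_0_iff)
  qed
  moreover have "sorted (a @ v @ t)"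
    using a assms by (fastforce simp: ordered_words_def sorted_append)
  moreover have "set (a @ v @ t) \<subseteq> {..<9}" using assms by (fastforce simp: ordered_words_def)
  ultimately show ?thesis by (simp add: ordered_words_def)
qed

definition osp_words :: "nat list set" where
  "osp_words = {w \<in> ordered_words {..<9}. set w \<inter> {1..5} \<noteq> {}}"

lemma kU_I: "x \<in> osp12 \<Longrightarrow> \<iota> x * u \<in> kU"
  unfolding kU_def by (intro uea.span_base) blast

lemma Uk_I: "x \<in> osp12 \<Longrightarrow> u * \<iota> x \<in> Uk"
  unfolding Uk_def by (intro uea.span_base) blast

text \<open>
  Multiplying an ordered monomial on the left by an element of \<open>\<kk>\<close> only affects its middle part: the letter moves
  past the central \<open>z\<close>, and the resulting product of elements of \<open>\<kk>\<close> is straightened within \<open>\<kk>\<close>, leaving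
  a non-empty word. Conversely, the first letter from \<open>\<kk>\<close> in an ordered monomial can be moved to the front.
\<close>
lemma kU_eq: "kU = uea.span (word_prod ` osp_words)"
proof
  show "kU \<subseteq> uea.span (word_prod ` osp_words)"
    unfolding kU_def
  proof (rule uea.span_minimal, clarify)
    fix x u assume x: "x \<in> osp12"
    have "word_prod [j] * word_prod w \<in> uea.span (word_prod ` osp_words)"
      if j: "j \<in> {1..5}" and w: "w \<in> ordered_words {..<9}" for j w
    proof -
      obtain a v t where avt: "w = a @ v @ t" "set a \<subseteq> {0}" "v \<in> ordered_words {1..5}" "t \<in> ordered_words {6..8}"
        using ordered_words_split[OF w] by blast
      have "word_prod a * (y * word_prod t) \<in> uea.span (word_prod ` osp_words)"
        if "y \<in> uea.span (word_prod ` (ordered_words {1..5} - {[]}))" for y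
      proof (rule span_mult_left)
        show "y * word_prod t \<in> uea.span (word_prod ` {v @ t | v. v \<in> ordered_words {1..5} - {[]}})"
          by (rule span_mult_right[OF _ that]) (auto simp flip: word_prod_append intro!: uea.span_base)
      next
        fix y assume "y \<in> word_prod ` {v @ t | v. v \<in> ordered_words {1..5} - {[]}}"
        then obtain v' where v': "y = word_prod (v' @ t)" "v' \<in> ordered_words {1..5}" "v' \<noteq> []" by blast
        then have "set v' \<inter> {1..5} \<noteq> {}" by (cases v') (auto simp: ordered_words_def)
        then have "a @ v' @ t \<in> osp_words"
          using ordered_words_join[OF avt(2) v'(2) avt(4)] by (auto simp: osp_words_def)
        then show "word_prod a * y \<in> uea.span (word_prod ` osp_words)"
          unfolding v'(1) word_prod_append[symmetric] by (intro uea.span_base imageI)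
      qed
      moreover have "word_prod (j # v) \<in> uea.span (word_prod ` (ordered_words {1..5} - {[]}))"
        by (rule straightening[OF closed_osp]) (use j avt(3) in \<open>auto simp: ordered_words_def\<close>)
      ultimately have "word_prod a * (word_prod (j # v) * word_prod t) \<in> uea.span (word_prod ` osp_words)" by blast
      also have "word_prod a * (word_prod (j # v) * word_prod t) = word_prod [j] * word_prod w"
        using word_prod_z_central[OF avt(2), of "\<iota> (basis j)"]
        by (simp add: avt(1) word_prod_append flip: mult.assoc)
      finally show ?thesis .
    qed
    note step = this
    have ix: "\<iota> x \<in> uea.span (word_prod ` {[k] | k. k \<in> {1..5}})"
      by (rule \<iota>_in_span) (rule osp12_coord[OF x])
    have "\<iota> x * word_prod w \<in> uea.span (word_prod ` osp_words)" if w: "w \<in> ordered_words {..<9}" for w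
    proof (rule span_mult_right[OF _ ix])
      fix y assume "y \<in> word_prod ` {[k] | k. k \<in> {1..5}}"
      then obtain j where "j \<in> {1..5}" "y = word_prod [j]" by blast
      then show "y * word_prod w \<in> uea.span (word_prod ` osp_words)" using step[OF _ w] by blast
    qed
    then show "\<iota> x * u \<in> uea.span (word_prod ` osp_words)"
      using span_mult_left[OF _ ordered_words_span, of "\<iota> x" "word_prod ` osp_words" u] by blast
  qed simp
next
  show "uea.span (word_prod ` osp_words) \<subseteq> kU"
  proof (rule uea.span_minimal, clarify)
    fix w assume w: "w \<in> osp_words"
    then obtain a v t where avt: "w = a @ v @ t" "set a \<subseteq> {0}" "v \<in> ordered_words {1..5}" "t \<in> ordered_words {6..8}"
      using ordered_words_split[of w] by (auto simp: osp_words_def)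
    have "v \<noteq> []"
    proof
      assume "v = []"
      then have "set w \<subseteq> {0} \<union> {6..8}" using avt by (auto simp: ordered_words_def)
      then show False using w by (fastforce simp: osp_words_def)
    qed
    then obtain j v' where v: "v = j # v'" by (cases v) auto
    then have j: "basis j \<in> osp12" using avt(3) by (intro basis_osp12) (simp add: ordered_words_def)
    have "word_prod w = \<iota> (basis j) * (word_prod a * word_prod v' * word_prod t)"
      using word_prod_z_central[OF avt(2), of "\<iota> (basis j)"]
      by (simp add: avt(1) v word_prod_append flip: mult.assoc)
    then show "word_prod w \<in> kU" using kU_I[OF j] by simp
  qed (simp add: kU_def)
qed

lemma kU_mult_right: "a \<in> kU \<Longrightarrow> a * u \<in> kU"
  unfolding kU_def
  by (rule span_mult_right) (use kU_I[unfolded kU_def] in \<open>auto simp: mult.assoc\<close>)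

lemma kU_z: "a \<in> kU \<Longrightarrow> \<iota> g_z ^ m * a \<in> kU"
  by (simp add: z_power_central kU_mult_right)

lemma Uk_mult_left: "a \<in> Uk \<Longrightarrow> u * a \<in> Uk"
  unfolding Uk_def
  by (rule span_mult_left) (use Uk_I[unfolded Uk_def] in \<open>auto simp flip: mult.assoc\<close>)

lemma kU_diff: "a \<in> kU \<Longrightarrow> b \<in> kU \<Longrightarrow> a - b \<in> kU"
  and kU_add: "a \<in> kU \<Longrightarrow> b \<in> kU \<Longrightarrow> a + b \<in> kU"
  and kU_uminus: "a \<in> kU \<Longrightarrow> - a \<in> kU"
  unfolding kU_def by (simp_all add: uea.span_diff uea.span_add uea.span_neg)

lemma osp12_gens: "g_k \<in> osp12" "g_k1 \<in> osp12" "g_k2 \<in> osp12" "g_e' \<in> osp12" "g_f' \<in> osp12"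
  by (simp_all add: osp12_iff basis_entries)

section \<open>Right multiplication by the odd part of osp(1|2)\<close>

definition beta_p :: "nat \<Rightarrow> uea" where
  "beta_p n = peval (beta_pred n) (\<iota> g_p)"

text \<open>
  The difference is \<open>v\<^sub>\<kk> \<alpha>\<^sub>n(p)\<close>. Apart from the degree bound, this is the only property of the polynomials that matters; \<open>\<alpha>\<^sub>n\<close> disappears
  modulo \<open>\<kk>U\<close>.
\<close>
lemma p_power_mod:
  "\<iota> g_p ^ n * \<iota> g_e' - beta_p n * \<iota> g_e \<in> kU"
  "\<iota> g_p ^ n * \<iota> g_f' - beta_p n * \<iota> g_f \<in> kU"
proof -
  obtain \<alpha> where "p_power_relation n \<alpha> (beta_pred n)" using beta_pred_relation by blast
  then have "\<iota> g_p ^ n * \<iota> (v_k a b) - beta_p n * \<iota> (v_p a b) = \<iota> (v_k a b) * peval \<alpha> (\<iota> g_p)" for a b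
    by (simp add: p_power_relation_def beta_p_def)
  from this[of 1 0] this[of 0 1]
  show "\<iota> g_p ^ n * \<iota> g_e' - beta_p n * \<iota> g_e \<in> kU"
    "\<iota> g_p ^ n * \<iota> g_f' - beta_p n * \<iota> g_f \<in> kU"
    by (simp_all add: \<iota>_v kU_I osp12_gens)
qed

text \<open>
  The even part of \<open>\<kk>\<close> commutes with \<open>p\<close>, so it can be moved to the left through \<open>\<beta>\<^sub>n\<^sub>-\<^sub>1(p)\<close>.
\<close>
lemma beta_p_k:
  "beta_p n * (\<iota> g_k * u) \<in> kU" "beta_p n * (\<iota> g_k1 * u) \<in> kU" "beta_p n * (\<iota> g_k2 * u) \<in> kU"
  using peval_commute[OF p_k, of "beta_pred n"] peval_commute[OF p_k1, of "beta_pred n"]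
    peval_commute[OF p_k2, of "beta_pred n"]
  by (simp_all add: beta_p_def mult.assoc kU_I osp12_gens flip: mult.assoc)
    (simp_all add: mult.assoc kU_I osp12_gens)

text \<open>
  In each of the following products, \<open>e'\<close> or \<open>f'\<close> is moved to the left until it meets \<open>p\<^sup>n\<close>, where
  \<open>p_power_mod\<close> applies. Squares and anticommutators of \<open>e, f\<close> lie in the even part of \<open>\<kk>\<close> and vanish
  by \<open>beta_p_k\<close>.
\<close>
lemma mod_e_e': "\<iota> g_p ^ n * \<iota> g_e * \<iota> g_e' \<in> kU"
proof -
  have "\<iota> g_p ^ n * \<iota> g_e * \<iota> g_e' =
    - ((\<iota> g_p ^ n * \<iota> g_e' - beta_p n * \<iota> g_e) * \<iota> g_e) + beta_p n * (\<iota> g_k2 * 1)"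
    by (simp add: mult.assoc odd_relations left_diff_distrib odd_squares)
  then show ?thesis by (simp only: kU_add kU_uminus kU_mult_right p_power_mod beta_p_k)
qed

lemma mod_f_f': "\<iota> g_p ^ n * \<iota> g_f * \<iota> g_f' \<in> kU"
proof -
  have "\<iota> g_p ^ n * \<iota> g_f * \<iota> g_f' =
    - ((\<iota> g_p ^ n * \<iota> g_f' - beta_p n * \<iota> g_f) * \<iota> g_f) - beta_p n * (\<iota> g_k1 * 1)"
    by (simp add: mult.assoc odd_relations left_diff_distrib odd_squares)
  then show ?thesis by (simp only: kU_diff kU_uminus kU_mult_right p_power_mod beta_p_k)
qed

lemma mod_f_e': "\<iota> g_p ^ n * \<iota> g_f * \<iota> g_e' + (beta_p n * \<iota> g_e * \<iota> g_f - \<iota> g_p ^ (n + 1)) \<in> kU"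
proof -
  have "\<iota> g_p ^ n * \<iota> g_f * \<iota> g_e' + (beta_p n * \<iota> g_e * \<iota> g_f - \<iota> g_p ^ (n + 1))
    = - ((\<iota> g_p ^ n * \<iota> g_e' - beta_p n * \<iota> g_e) * \<iota> g_f)"
    by (simp add: mult.assoc odd_relations left_diff_distrib right_diff_distrib distrib_left power_commutes)
  then show ?thesis by (simp only: kU_uminus kU_mult_right p_power_mod)
qed

lemma mod_e_f': "\<iota> g_p ^ n * \<iota> g_e * \<iota> g_f' - (beta_p n * \<iota> g_e * \<iota> g_f - \<iota> g_p ^ (n + 1)) \<in> kU"
proof -
  have "\<iota> g_p ^ n * \<iota> g_e * \<iota> g_f' - (beta_p n * \<iota> g_e * \<iota> g_f - \<iota> g_p ^ (n + 1))
    = - ((\<iota> g_p ^ n * \<iota> g_f' - beta_p n * \<iota> g_f) * \<iota> g_e) - beta_p n * (\<iota> g_k * 1)"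
    by (simp add: mult.assoc odd_relations left_diff_distrib right_diff_distrib distrib_left power_commutes)
  then show ?thesis by (simp only: kU_diff kU_uminus kU_mult_right p_power_mod beta_p_k)
qed

lemma mod_e_f_e': "\<iota> g_p ^ n * \<iota> g_e * \<iota> g_f * \<iota> g_e' - (\<iota> g_p ^ (n + 1) * \<iota> g_e - beta_p n * \<iota> g_e) \<in> kU"
proof -
  have ep: "\<iota> g_e * \<iota> g_p = \<iota> g_p * \<iota> g_e - \<iota> g_e'" by (simp add: p_odd)
  have "\<iota> g_e * \<iota> g_f * \<iota> g_e' = \<iota> g_e * (- (\<iota> g_e' * \<iota> g_f) + \<iota> g_p)"
    by (simp add: mult.assoc odd_relations)
  also have "\<dots> = - (\<iota> g_e * \<iota> g_e') * \<iota> g_f + \<iota> g_e * \<iota> g_p"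
    by (simp add: distrib_left right_diff_distrib mult.assoc)
  also have "\<dots> = \<iota> g_e' * \<iota> g_e * \<iota> g_f + \<iota> g_p * \<iota> g_e - \<iota> g_e'"
    by (simp add: odd_relations ep)
  finally have "\<iota> g_p ^ n * (\<iota> g_e * \<iota> g_f * \<iota> g_e') = \<iota> g_p ^ n * (\<iota> g_e' * \<iota> g_e * \<iota> g_f + \<iota> g_p * \<iota> g_e - \<iota> g_e')"
    by simp
  moreover have "beta_p n * (\<iota> g_e * (\<iota> g_e * u)) = - (beta_p n * (\<iota> g_k2 * u))" for u
    by (simp add: odd_squares flip: mult.assoc)
  ultimately have "\<iota> g_p ^ n * \<iota> g_e * \<iota> g_f * \<iota> g_e' - (\<iota> g_p ^ (n + 1) * \<iota> g_e - beta_p n * \<iota> g_e)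
    = (\<iota> g_p ^ n * \<iota> g_e' - beta_p n * \<iota> g_e) * (\<iota> g_e * \<iota> g_f)
      - (\<iota> g_p ^ n * \<iota> g_e' - beta_p n * \<iota> g_e) - beta_p n * (\<iota> g_k2 * \<iota> g_f)"
    by (simp add: mult.assoc left_diff_distrib right_diff_distrib distrib_left power_commutes)
       (simp add: power_commutes flip: mult.assoc)
  then show ?thesis by (simp only: kU_diff kU_mult_right p_power_mod beta_p_k)
qed

text \<open>
  The product \<open>p\<^sup>n e f'\<close> being known, one multiplies it by \<open>-f\<close>. In contrast to the other cases
  \<open>e f\<^sup>2 = e k\<^sub>1\<close> leaves the remainder \<open>[e, k\<^sub>1] = f\<close>, which is the source of the term \<open>\<beta>\<^sub>n\<^sub>-\<^sub>1(p) f\<close>.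
\<close>
lemma mod_e_f_f': "\<iota> g_p ^ n * \<iota> g_e * \<iota> g_f * \<iota> g_f' - (\<iota> g_p ^ (n + 1) * \<iota> g_f - beta_p n * \<iota> g_f) \<in> kU"
proof -
  have eff: "\<iota> g_e * \<iota> g_f * \<iota> g_f = \<iota> g_k1 * \<iota> g_e + \<iota> g_f"
    by (simp add: mult.assoc odd_squares e_k1)
  have "beta_p n * (\<iota> g_e * (\<iota> g_f * \<iota> g_f)) = beta_p n * (\<iota> g_k1 * \<iota> g_e) + beta_p n * \<iota> g_f"
    using arg_cong[OF eff, of "\<lambda>u. beta_p n * u"] by (simp add: distrib_left mult.assoc)
  moreover have "\<iota> g_p ^ n * \<iota> g_e * \<iota> g_f * \<iota> g_f' = - (\<iota> g_p ^ n * \<iota> g_e * \<iota> g_f' * \<iota> g_f)"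
    by (simp add: mult.assoc odd_relations(3))
  ultimately have "\<iota> g_p ^ n * \<iota> g_e * \<iota> g_f * \<iota> g_f' - (\<iota> g_p ^ (n + 1) * \<iota> g_f - beta_p n * \<iota> g_f)
    = - ((\<iota> g_p ^ n * \<iota> g_e * \<iota> g_f' - (beta_p n * \<iota> g_e * \<iota> g_f - \<iota> g_p ^ (n + 1))) * \<iota> g_f)
      - beta_p n * (\<iota> g_k1 * \<iota> g_e)"
    by (simp add: left_diff_distrib mult.assoc)
  then show ?thesis by (simp only: kU_diff kU_uminus kU_mult_right mod_e_f' beta_p_k)
qed

section \<open>Independence of the claimed basis\<close>

definition exp_word :: "nat \<Rightarrow> nat \<Rightarrow> nat \<Rightarrow> nat \<Rightarrow> nat \<Rightarrow> nat \<Rightarrow> nat \<Rightarrow> nat \<Rightarrow> nat \<Rightarrow> nat list" where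
  "exp_word m r1 r2 r3 r4 r5 s1 s2 s3 = replicate m 0 @ replicate r1 1 @ replicate r2 2 @ replicate r3 3
     @ replicate r4 4 @ replicate r5 5 @ replicate s1 6 @ replicate s2 7 @ replicate s3 8"

lemma word_prod_exp_word: "word_prod (exp_word m r1 r2 r3 r4 r5 s1 s2 s3) = vec_of (Idx_iii m r1 r2 r3 r4 r5 s1 s2 s3)"
  by (simp add: exp_word_def word_prod_append word_prod_replicate basis_simps mult.assoc)

lemma count_list_exp_word:
  "count_list (exp_word m r1 r2 r3 r4 r5 s1 s2 s3) i =
    (if i = 0 then m else if i = 1 then r1 else if i = 2 then r2 else if i = 3 then r3 else
     if i = 4 then r4 else if i = 5 then r5 else if i = 6 then s1 else if i = 7 then s2 else
     if i = 8 then s3 else 0)"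
  by (simp add: exp_word_def count_list_replicate)

lemma exp_word_eq_iff:
  "exp_word m r1 r2 r3 r4 r5 s1 s2 s3 = exp_word m' r1' r2' r3' r4' r5' s1' s2' s3' \<longleftrightarrow>
   m = m' \<and> r1 = r1' \<and> r2 = r2' \<and> r3 = r3' \<and> r4 = r4' \<and> r5 = r5' \<and> s1 = s1' \<and> s2 = s2' \<and> s3 = s3'"
  (is "?w = ?w' \<longleftrightarrow> _")
proof
  assume "?w = ?w'"
  then have c: "count_list ?w i = count_list ?w' i" for i by simp
  show "m = m' \<and> r1 = r1' \<and> r2 = r2' \<and> r3 = r3' \<and> r4 = r4' \<and> r5 = r5' \<and> s1 = s1' \<and> s2 = s2' \<and> s3 = s3'"
    using c[of 0] c[of 1] c[of 2] c[of 3] c[of 4] c[of 5] c[of 6] c[of 7] c[of 8]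
    by (simp add: count_list_exp_word)
qed simp

lemma sorted_exp_word: "sorted (exp_word m r1 r2 r3 r4 r5 s1 s2 s3)"
  by (auto simp: exp_word_def sorted_append)

lemma exp_word_ordered:
  assumes "r4 \<in> {0,1}" "r5 \<in> {0,1}" "s2 \<in> {0,1}" "s3 \<in> {0,1}"
  shows "exp_word m r1 r2 r3 r4 r5 s1 s2 s3 \<in> ordered_words {..<9}"
proof -
  have "set (exp_word m r1 r2 r3 r4 r5 s1 s2 s3) \<subseteq> {..<9}" by (auto simp: exp_word_def)
  moreover have "count_list (exp_word m r1 r2 r3 r4 r5 s1 s2 s3) i \<le> 1" if "basis_parity i = 1" for i
  proof -
    have "i \<in> {4,5,7,8}" using that by (simp add: basis_parity_def split: if_splits)
    then show ?thesis using assms by (elim insertE emptyE) (simp_all add: count_list_exp_word)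
  qed
  ultimately show ?thesis using sorted_exp_word by (simp add: ordered_words_def)
qed

lemma count_mset_list: "count (mset w) i = count_list w i"
  by (induction w) auto

lemma ordered_exp_word:
  assumes "w \<in> ordered_words {..<9}"
  obtains m r1 r2 r3 r4 r5 s1 s2 s3 where "w = exp_word m r1 r2 r3 r4 r5 s1 s2 s3"
    "r4 \<in> {0,1}" "r5 \<in> {0,1}" "s2 \<in> {0,1}" "s3 \<in> {0,1}"
proof
  let ?c = "count_list w"
  show "w = exp_word (?c 0) (?c 1) (?c 2) (?c 3) (?c 4) (?c 5) (?c 6) (?c 7) (?c 8)"
  proof (rule sorted_mset_eqI[OF _ sorted_exp_word])
    show "sorted w" using assms by (simp add: ordered_words_def)
    show "mset w = mset (exp_word (?c 0) (?c 1) (?c 2) (?c 3) (?c 4) (?c 5) (?c 6) (?c 7) (?c 8))"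
    proof (rule multiset_eqI)
      fix i
      show "count (mset w) i = count (mset (exp_word (?c 0) (?c 1) (?c 2) (?c 3) (?c 4) (?c 5) (?c 6) (?c 7) (?c 8))) i"
      proof (cases "i < 9")
        case True
        then have "i \<in> {0,1,2,3,4,5,6,7,8}" by auto
        then show ?thesis unfolding count_mset_list count_list_exp_word by auto
      next
        case False
        then have "i \<notin> set w" using assms by (auto simp: ordered_words_def)
        then have "?c i = 0" by (simp add: count_list_0_iff)
        then show ?thesis using False unfolding count_mset_list count_list_exp_word by auto
      qed
    qed
  qed
  have odd: "count_list w i \<le> 1" if "basis_parity i = 1" for i
    using assms that by (auto simp: ordered_words_def)
  have "?c 4 \<le> 1" "?c 5 \<le> 1" "?c 7 \<le> 1" "?c 8 \<le> 1"
    by (rule odd, simp add: basis_parity_def)+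
  then show "?c 4 \<in> {0,1}" "?c 5 \<in> {0,1}" "?c 7 \<in> {0,1}" "?c 8 \<in> {0,1}" by auto
qed

text \<open>
  The PBW monomial that distinguishes a vector from all others. For type (ii) this is \<open>z\<^sup>m p\<^sup>n\<^sup>+\<^sup>1\<close>
  and not one of the monomials with \<open>ef\<close>, which are shared between different \<open>n\<close>.
\<close>
fun lead_word :: "index \<Rightarrow> nat list" where
  "lead_word (Idx_e m n) = exp_word m 0 0 0 0 0 n 1 0"
| "lead_word (Idx_f m n) = exp_word m 0 0 0 0 0 n 0 1"
| "lead_word (Idx_ii m n) = exp_word m 0 0 0 0 0 (n + 1) 0 0"
| "lead_word (Idx_iii m r1 r2 r3 r4 r5 s1 s2 s3) = exp_word m r1 r2 r3 r4 r5 s1 s2 s3"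

lemma vec_of_expand:
  "vec_of (Idx_e m n) = word_prod (exp_word m 0 0 0 0 0 n 1 0)"
  "vec_of (Idx_f m n) = word_prod (exp_word m 0 0 0 0 0 n 0 1)"
  "vec_of (Idx_ii m n) = (\<Sum>j\<le>degree (beta_pred n). uscale (coeff (beta_pred n) j) (word_prod (exp_word m 0 0 0 0 0 j 1 1)))
     - word_prod (exp_word m 0 0 0 0 0 (n + 1) 0 0)"
  "vec_of (Idx_iii m r1 r2 r3 r4 r5 s1 s2 s3) = word_prod (exp_word m r1 r2 r3 r4 r5 s1 s2 s3)"
  by (simp_all add: word_prod_exp_word peval_def sum_distrib_left sum_distrib_right
      flip: uscale_mult_left uscale_mult_right)

lemma lead_word_ordered: "t \<in> indices \<Longrightarrow> lead_word t \<in> ordered_words {..<9}"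
  unfolding indices_def by (auto intro!: exp_word_ordered)

lemma indices_iii:
  "Idx_iii m r1 r2 r3 r4 r5 s1 s2 s3 \<in> indices \<Longrightarrow> \<not> (r1 = 0 \<and> r2 = 0 \<and> r3 = 0 \<and> r4 = 0 \<and> r5 = 0)"
  by (auto simp: indices_def)

text \<open>
  Up to signs, the coordinates at the distinguishing monomials form a family dual to the vectors.
\<close>
lemma pbw_coord_lead:
  assumes "t \<in> indices" "t' \<in> indices"
  shows "pbw_coord (lead_word t) (vec_of t') = (if t = t' then (case t of Idx_ii _ _ \<Rightarrow> -1 | _ \<Rightarrow> 1) else 0)"
proof -
  note L = lead_word_ordered[OF assms(1)]
  show ?thesis
  proof (cases "\<exists>m n. t' = Idx_ii m n")
    case False
    then have v: "vec_of t' = word_prod (lead_word t')"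
      by (cases t') (simp_all add: vec_of_expand del: vec_of.simps)
    have "lead_word t' = lead_word t \<longleftrightarrow> t = t'"
      using assms False by (cases t; cases t') (auto simp: exp_word_eq_iff dest: indices_iii)
    then show ?thesis unfolding v using False
      by (simp add: pbw_coord_word_prod L lead_word_ordered assms split: index.split)
  next
    case True
    then obtain m n where t': "t' = Idx_ii m n" by blast
    have r: "exp_word m 0 0 0 0 0 j 1 1 \<in> ordered_words {..<9}" "exp_word m 0 0 0 0 0 j 0 0 \<in> ordered_words {..<9}" for j
      by (intro exp_word_ordered; simp)+
    have ne: "exp_word m 0 0 0 0 0 j 1 1 \<noteq> lead_word t" for j
      using assms(1) by (cases t) (auto simp: exp_word_eq_iff dest: indices_iii)
    have eq: "exp_word m 0 0 0 0 0 (n + 1) 0 0 = lead_word t \<longleftrightarrow> t = t'"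
      using assms(1) unfolding t' by (cases t) (auto simp: exp_word_eq_iff dest: indices_iii)
    have "pbw_coord (lead_word t) (vec_of t') = (if t = t' then -1 else 0)"
      unfolding t' vec_of_expand(3) pbw_coord_diff pbw_coord_sum pbw_coord_scale
        pbw_coord_word_prod[OF r(1) L] pbw_coord_word_prod[OF r(2) L] eq[unfolded t'] using ne by simp
    then show ?thesis using t' by auto
  qed
qed

lemma vec_of_independent: "inj_on vec_of indices \<and> uea.independent (vec_of ` indices)"
proof (rule family_independent, rule ballI)
  fix S c t assume S: "finite S" "S \<subseteq> indices" "(\<Sum>i\<in>S. uscale (c i) (vec_of i)) = 0" "t \<in> S"
  define \<epsilon> :: complex where "\<epsilon> = (case t of Idx_ii _ _ \<Rightarrow> -1 | _ \<Rightarrow> 1)"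
  have "0 = pbw_coord (lead_word t) 0" using pbw_coord_diff[of "lead_word t" 0 0] by simp
  also have "\<dots> = (\<Sum>i\<in>S. c i * pbw_coord (lead_word t) (vec_of i))"
    unfolding S(3)[symmetric] by (simp add: pbw_coord_sum pbw_coord_scale del: vec_of.simps)
  also have "\<dots> = (\<Sum>i\<in>S. if t = i then c t * \<epsilon> else 0)"
  proof (rule sum.cong[OF refl])
    fix i assume "i \<in> S"
    then have "pbw_coord (lead_word t) (vec_of i) = (if t = i then \<epsilon> else 0)"
      unfolding \<epsilon>_def using S(2,4) by (intro pbw_coord_lead) auto
    then show "c i * pbw_coord (lead_word t) (vec_of i) = (if t = i then c t * \<epsilon> else 0)" by simp
  qed
  also have "\<dots> = c t * \<epsilon>" using S(1,4) by simp
  finally show "c t = 0" by (simp add: \<epsilon>_def split: index.splits)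
qed

section \<open>The span of the claimed basis\<close>

abbreviation (input) vec_span :: "uea set" where "vec_span \<equiv> uea.span (vec_of ` indices)"

lemma vec_span_index: "t \<in> indices \<Longrightarrow> vec_of t \<in> vec_span"
  by (intro uea.span_base imageI)

lemma osp_words_index:
  assumes "w \<in> osp_words"
  shows "\<exists>t\<in>indices. word_prod w = vec_of t"
proof -
  have "w \<in> ordered_words {..<9}" using assms by (simp add: osp_words_def)
  then obtain m r1 r2 r3 r4 r5 s1 s2 s3 where w: "w = exp_word m r1 r2 r3 r4 r5 s1 s2 s3"
    and r: "r4 \<in> {0,1}" "r5 \<in> {0,1}" "s2 \<in> {0,1}" "s3 \<in> {0,1}"
    by (rule ordered_exp_word)
  from assms obtain i where i: "i \<in> set w" "i \<in> {1..5}" unfolding osp_words_def by blast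
  then have "count_list w i \<noteq> 0" "i \<in> {1,2,3,4,5}" by (auto simp: count_list_0_iff)
  then have "r1 \<ge> 1 \<or> r2 \<ge> 1 \<or> r3 \<ge> 1 \<or> r4 \<ge> 1 \<or> r5 \<ge> 1"
    unfolding w count_list_exp_word by (elim insertE emptyE) simp_all
  with r have "Idx_iii m r1 r2 r3 r4 r5 s1 s2 s3 \<in> indices" by (simp add: indices_def)
  then show ?thesis unfolding w word_prod_exp_word by blast
qed

lemma kU_subset_vec_span: "kU \<subseteq> vec_span"
  unfolding kU_eq
proof (rule uea.span_minimal, rule image_subsetI)
  fix w assume "w \<in> osp_words"
  then show "word_prod w \<in> vec_span" using osp_words_index vec_span_index by metis
qed simp

lemma poly_e_vec_span: "\<iota> g_z ^ m * (peval q (\<iota> g_p) * \<iota> g_e) \<in> vec_span"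
  and poly_f_vec_span: "\<iota> g_z ^ m * (peval q (\<iota> g_p) * \<iota> g_f) \<in> vec_span"
proof -
  have "\<iota> g_z ^ m * \<iota> g_p ^ i * \<iota> g_e \<in> vec_span" "\<iota> g_z ^ m * \<iota> g_p ^ i * \<iota> g_f \<in> vec_span" for i
    using vec_span_index[of "Idx_e m i"] vec_span_index[of "Idx_f m i"] by (auto simp: indices_def)
  then show "\<iota> g_z ^ m * (peval q (\<iota> g_p) * \<iota> g_e) \<in> vec_span"
    "\<iota> g_z ^ m * (peval q (\<iota> g_p) * \<iota> g_f) \<in> vec_span"
    by (auto simp: peval_def sum_distrib_left sum_distrib_right mult.assoc
        simp flip: uscale_mult_left uscale_mult_right intro!: uea.span_sum uea.span_scale)
qed

lemma power_e_vec_span: "\<iota> g_z ^ m * (\<iota> g_p ^ n * \<iota> g_e) \<in> vec_span"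
  and power_f_vec_span: "\<iota> g_z ^ m * (\<iota> g_p ^ n * \<iota> g_f) \<in> vec_span"
  using poly_e_vec_span[of m "monom 1 n"] poly_f_vec_span[of m "monom 1 n"] by (simp_all add: peval_monom)

lemma beta_vec_span: "\<iota> g_z ^ m * (beta_p n * \<iota> g_e) \<in> vec_span" "\<iota> g_z ^ m * (beta_p n * \<iota> g_f) \<in> vec_span"
  by (simp_all only: beta_p_def poly_e_vec_span poly_f_vec_span)

lemma ii_vec_span: "\<iota> g_z ^ m * (beta_p n * \<iota> g_e * \<iota> g_f - \<iota> g_p ^ (n + 1)) \<in> vec_span"
  using vec_span_index[of "Idx_ii m n"]
  by (simp add: indices_def beta_p_def right_diff_distrib mult.assoc)

lemma vec_span_mod:
  assumes "x - y \<in> kU" "\<iota> g_z ^ m * y \<in> vec_span"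
  shows "\<iota> g_z ^ m * x \<in> vec_span"
proof -
  have "\<iota> g_z ^ m * (x - y) \<in> vec_span" using assms(1) kU_z kU_subset_vec_span by blast
  from uea.span_add[OF this assms(2)] show ?thesis by (simp add: right_diff_distrib)
qed

lemma vec_span_p_words:
  assumes "s2 \<in> {0,1}" "s3 \<in> {0,1::nat}" "x \<in> {g_e', g_f'}"
  shows "\<iota> g_z ^ m * (\<iota> g_p ^ n * \<iota> g_e ^ s2 * \<iota> g_f ^ s3 * \<iota> x) \<in> vec_span"
proof -
  have zero: "u \<in> kU \<Longrightarrow> \<iota> g_z ^ m * u \<in> vec_span" for u
    using kU_z kU_subset_vec_span by blast
  have c: "\<iota> g_z ^ m * (\<iota> g_p ^ n * \<iota> g_e') \<in> vec_span" "\<iota> g_z ^ m * (\<iota> g_p ^ n * \<iota> g_f') \<in> vec_span"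
    "\<iota> g_z ^ m * (\<iota> g_p ^ n * \<iota> g_e * \<iota> g_e') \<in> vec_span" "\<iota> g_z ^ m * (\<iota> g_p ^ n * \<iota> g_f * \<iota> g_f') \<in> vec_span"
    "\<iota> g_z ^ m * (\<iota> g_p ^ n * \<iota> g_e * \<iota> g_f') \<in> vec_span"
    "\<iota> g_z ^ m * (\<iota> g_p ^ n * \<iota> g_e * \<iota> g_f * \<iota> g_e') \<in> vec_span"
    "\<iota> g_z ^ m * (\<iota> g_p ^ n * \<iota> g_e * \<iota> g_f * \<iota> g_f') \<in> vec_span"
    using vec_span_mod[OF p_power_mod(1) beta_vec_span(1)] vec_span_mod[OF p_power_mod(2) beta_vec_span(2)]
      zero[OF mod_e_e'] zero[OF mod_f_f'] vec_span_mod[OF mod_e_f' ii_vec_span]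
      vec_span_mod[OF mod_e_f_e'] vec_span_mod[OF mod_e_f_f'] power_e_vec_span beta_vec_span power_f_vec_span
    by (simp_all only: right_diff_distrib uea.span_diff)
  have d: "\<iota> g_z ^ m * (\<iota> g_p ^ n * \<iota> g_f * \<iota> g_e') \<in> vec_span"
  proof (rule vec_span_mod)
    show "\<iota> g_p ^ n * \<iota> g_f * \<iota> g_e' - (- (beta_p n * \<iota> g_e * \<iota> g_f - \<iota> g_p ^ (n + 1))) \<in> kU"
      using mod_f_e'[of n] by (simp only: diff_minus_eq_add)
    show "\<iota> g_z ^ m * - (beta_p n * \<iota> g_e * \<iota> g_f - \<iota> g_p ^ (n + 1)) \<in> vec_span"
      using uea.span_neg[OF ii_vec_span[of m n]] by (simp only: mult_minus_right)
  qed
  show ?thesis using assms c d by auto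
qed

lemma vec_span_mult_right: "x \<in> {g_e', g_f'} \<Longrightarrow> u * \<iota> x \<in> vec_span"
proof (rule span_mult_right[OF _ ordered_words_span])
  fix y assume x: "x \<in> {g_e', g_f'}" and "y \<in> word_prod ` ordered_words {..<9}"
  then obtain w where w: "y = word_prod w" "w \<in> ordered_words {..<9}" by blast
  show "y * \<iota> x \<in> vec_span"
  proof (cases "w \<in> osp_words")
    case True
    then have "word_prod w \<in> kU" unfolding kU_eq by (intro uea.span_base imageI)
    then show ?thesis using kU_mult_right kU_subset_vec_span w(1) by blast
  next
    case False
    from w(2) obtain m r1 r2 r3 r4 r5 s1 s2 s3 where exp_word: "w = exp_word m r1 r2 r3 r4 r5 s1 s2 s3"
      and r: "s2 \<in> {0,1}" "s3 \<in> {0,1}"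
      by (rule ordered_exp_word)
    have "i \<notin> set w" if "i \<in> {1..5}" for i
      using False w(2) that by (auto simp: osp_words_def)
    then have "count_list w i = 0" if "i \<in> {1..5}" for i
      using that by (simp add: count_list_0_iff)
    from this[of 1] this[of 2] this[of 3] this[of 4] this[of 5]
    have "r1 = 0" "r2 = 0" "r3 = 0" "r4 = 0" "r5 = 0" by (simp_all add: exp_word count_list_exp_word)
    then have "y = \<iota> g_z ^ m * (\<iota> g_p ^ s1 * \<iota> g_e ^ s2 * \<iota> g_f ^ s3)"
      by (simp add: w(1) exp_word word_prod_exp_word mult.assoc)
    then show ?thesis using vec_span_p_words[OF r x, of m s1] by (simp add: mult.assoc)
  qed
qed

text \<open>
  \<open>k, k\<^sub>1, k\<^sub>2\<close> are polynomials in \<open>e', f'\<close> without constant term, so right multiplication by them is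
  covered by right multiplication by \<open>e'\<close> and \<open>f'\<close>.
\<close>
lemma Uk_subset_vec_span: "Uk \<subseteq> vec_span"
  unfolding Uk_def
proof (rule uea.span_minimal, clarify)
  fix x u assume x: "x \<in> osp12"
  have r: "u * \<iota> g_e' \<in> vec_span" "u * \<iota> g_f' \<in> vec_span" for u using vec_span_mult_right by auto
  have k: "\<iota> g_k = - (\<iota> g_f' * \<iota> g_e') - \<iota> g_e' * \<iota> g_f'" "\<iota> g_k1 = - (\<iota> g_f' * \<iota> g_f')" "\<iota> g_k2 = \<iota> g_e' * \<iota> g_e'"
    by (simp_all add: odd_relations odd_squares)
  have "u * \<iota> g_k \<in> vec_span" "u * \<iota> g_k1 \<in> vec_span" "u * \<iota> g_k2 \<in> vec_span"
    unfolding k using r[of "u * _"] by (simp_all add: right_diff_distrib uea.span_diff uea.span_neg flip: mult.assoc)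
  then have g: "u * \<iota> (basis j) \<in> vec_span" if "j \<in> {1..5}" for j
  proof -
    have "j \<in> {1,2,3,4,5}" using that by auto
    then show ?thesis using r[of u] \<open>u * \<iota> g_k \<in> vec_span\<close> \<open>u * \<iota> g_k1 \<in> vec_span\<close> \<open>u * \<iota> g_k2 \<in> vec_span\<close>
      by (elim insertE emptyE) (simp_all add: basis_simps)
  qed
  have ix: "\<iota> x \<in> uea.span (word_prod ` {[k] | k. k \<in> {1..5}})"
    by (rule \<iota>_in_span) (rule osp12_coord[OF x])
  show "u * \<iota> x \<in> vec_span"
  proof (rule span_mult_left[OF _ ix])
    fix y assume "y \<in> word_prod ` {[k] | k. k \<in> {1..5}}"
    then obtain j where "j \<in> {1..5}" "y = word_prod [j]" by blast
    then show "u * y \<in> vec_span" using g by simp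
  qed
qed simp

lemma subspace_I: "uea.subspace \<I>"
  unfolding \<I>_def by (rule uea.subspace_sums) (simp_all add: kU_def Uk_def)

lemma kU_I_subset: "a \<in> kU \<Longrightarrow> a \<in> \<I>" and Uk_I_subset: "a \<in> Uk \<Longrightarrow> a \<in> \<I>"
proof -
  have "0 \<in> kU" "0 \<in> Uk" by (simp_all add: kU_def Uk_def uea.span_zero)
  then show "a \<in> kU \<Longrightarrow> a \<in> \<I>" "a \<in> Uk \<Longrightarrow> a \<in> \<I>"
    unfolding \<I>_def using add.right_neutral add.left_neutral by (metis (mono_tags, lifting) mem_Collect_eq)+
qed

lemmas I_add = uea.subspace_add[OF subspace_I]
  and I_diff = uea.subspace_diff[OF subspace_I]
  and I_scale = uea.subspace_scale[OF subspace_I]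
  and I_sum = uea.subspace_sum[OF subspace_I]

lemma I_z: "a \<in> \<I> \<Longrightarrow> \<iota> g_z ^ m * a \<in> \<I>"
  unfolding \<I>_def using kU_z Uk_mult_left by (fastforce simp: distrib_left)

lemma I_mod: "x - y \<in> kU \<Longrightarrow> x \<in> Uk \<Longrightarrow> y \<in> \<I>"
  using I_diff[OF Uk_I_subset kU_I_subset, of x "x - y"] by simp

text \<open>
  For \<open>n = 0\<close>, \<open>e = pe' - e'p\<close>. For the step, \<open>p\<^sup>k e f e'\<close> lies in \<open>U\<kk>\<close> and is congruent to
  \<open>p\<^sup>k\<^sup>+\<^sup>1 e - \<beta>\<^sub>k\<^sub>-\<^sub>1(p) e\<close>; the second term involves only powers up to \<open>p\<^sup>k\<close>, which are known to be in \<open>\<I>\<close>.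
  The argument for \<open>f\<close> uses \<open>p\<^sup>k e f f'\<close>.
\<close>
lemma I_e: "\<iota> g_p ^ n * \<iota> g_e \<in> \<I>" and I_f: "\<iota> g_p ^ n * \<iota> g_f \<in> \<I>"
proof (induction n rule: less_induct)
  case (less n)
  have Uk: "u * \<iota> g_e' \<in> Uk" "u * \<iota> g_f' \<in> Uk" for u using Uk_I osp12_gens by auto
  { case 1
    show ?case
    proof (cases n)
      case 0
      have "\<iota> g_e = \<iota> g_p * \<iota> g_e' - \<iota> g_e' * \<iota> g_p" by (simp add: p_odd)
      then show ?thesis using 0 I_diff[OF Uk_I_subset kU_I_subset] Uk kU_I osp12_gens by simp
    next
      case (Suc k)
      have "beta_p k * \<iota> g_e \<in> \<I>"
        unfolding beta_p_def peval_def sum_distrib_right uscale_mult_left[symmetric]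
        using degree_beta_pred[of k] Suc by (intro I_sum I_scale less) auto
      from I_add[OF I_mod[OF mod_e_f_e'[of k] Uk(1)] this] show ?thesis
        by (simp add: Suc)
    qed
  next
    case 2
    show ?case
    proof (cases n)
      case 0
      have "\<iota> g_f = \<iota> g_p * \<iota> g_f' - \<iota> g_f' * \<iota> g_p" by (simp add: p_odd)
      then show ?thesis using 0 I_diff[OF Uk_I_subset kU_I_subset] Uk kU_I osp12_gens by simp
    next
      case (Suc k)
      have "beta_p k * \<iota> g_f \<in> \<I>"
        unfolding beta_p_def peval_def sum_distrib_right uscale_mult_left[symmetric]
        using degree_beta_pred[of k] Suc by (intro I_sum I_scale less) auto
      from I_add[OF I_mod[OF mod_e_f_f'[of k] Uk(2)] this] show ?thesis
        by (simp add: Suc)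
    qed
  }
qed

lemma I_ii: "beta_p n * \<iota> g_e * \<iota> g_f - \<iota> g_p ^ (n + 1) \<in> \<I>"
  by (rule I_mod[OF mod_e_f']) (simp add: Uk_I osp12_gens)

lemma vec_of_I: "t \<in> indices \<Longrightarrow> vec_of t \<in> \<I>"
proof (cases t)
  case (Idx_e m n)
  then show ?thesis using I_z[OF I_e, of m n] by (simp add: mult.assoc)
next
  case (Idx_f m n)
  then show ?thesis using I_z[OF I_f, of m n] by (simp add: mult.assoc)
next
  case (Idx_ii m n)
  then show ?thesis using I_z[OF I_ii, of m n] by (simp add: beta_p_def right_diff_distrib mult.assoc)
next
  case (Idx_iii m r1 r2 r3 r4 r5 s1 s2 s3)
  assume t: "t \<in> indices"
  have "lead_word t \<in> ordered_words {..<9}" by (rule lead_word_ordered[OF t])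
  moreover have "set (lead_word t) \<inter> {1..5} \<noteq> {}"
  proof -
    have c: "count_list (lead_word t) 1 = r1" "count_list (lead_word t) 2 = r2" "count_list (lead_word t) 3 = r3"
      "count_list (lead_word t) 4 = r4" "count_list (lead_word t) 5 = r5"
      by (simp_all add: Idx_iii count_list_exp_word)
    have "r1 \<noteq> 0 \<or> r2 \<noteq> 0 \<or> r3 \<noteq> 0 \<or> r4 \<noteq> 0 \<or> r5 \<noteq> 0"
      using indices_iii[OF t[unfolded Idx_iii]] by simp
    then have "1 \<in> set (lead_word t) \<or> 2 \<in> set (lead_word t) \<or> 3 \<in> set (lead_word t) \<or> 4 \<in> set (lead_word t) \<or> 5 \<in> set (lead_word t)"
      unfolding c[symmetric] count_list_0_iff by simp
    then show ?thesis by force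
  qed
  ultimately have "lead_word t \<in> osp_words" by (simp add: osp_words_def)
  then have "word_prod (lead_word t) \<in> kU" unfolding kU_eq by (intro uea.span_base imageI)
  then show ?thesis using kU_I_subset Idx_iii by (simp only: lead_word.simps word_prod_exp_word)
qed

lemma span_vec_of: "vec_span = \<I>"
proof
  show "vec_span \<subseteq> \<I>"
    by (rule uea.span_minimal[OF _ subspace_I]) (use vec_of_I in blast)
  show "\<I> \<subseteq> vec_span"
    unfolding \<I>_def using kU_subset_vec_span Uk_subset_vec_span uea.span_add by blast
qed

theorem theorem4p8:
  shows "inj_on vec_of indices \<and>
         uea.independent (vec_of ` indices) \<and>
         uea.span (vec_of ` indices) = \<I>"
  using vec_of_independent span_vec_of by blast

end
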